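(* Let $h$ be analytic in $\mathbb{D}=\{|z|<1\}$ with $h(0)=0$, $h'(0)=1$, and let $u(z)=h(z)+\frac{1}{2}(1-|z|^2)\,zh'(z)$ for $z\in\mathbb{D}$. Then: (1) if $h$ is convex (univalent) in $\mathbb{D}$, then $u$ is sense-preserving in $\mathbb{D}$; (2) if $h$ is a convex function of order $\alpha$ for some $\alpha$ with $-1/2\le\alpha<0$, then $u$ is sense-preserving in $\mathbb{D}$; in particular, $u$ is sense-preserving in $|z|<1$ if $h$ is a convex function of order $-1/2$; (3) if $h$ is univalent in $\mathbb{D}$, then $u$ is sense-preserving in the disk $|z|<\sqrt{7}-2$.
   Context: A function $u$ of class $C^1$ is sense-preserving in a domain if its Jacobian $J_u=|u_z|^2-|u_{\overline z}|^2$ is positive there. For $\alpha\in[-1/2,1)$, a locally univalent analytic function $h(z)=z+a_2z^2+\cdots$ in $\mathbb{D}$ is convex of order $\alpha$ if $\operatorname{Re}\big(1+zh''(z)/h'(z)\big)>\alpha$ for all $z\in\mathbb{D}$; convex of order $0$ is the usual notion of a convex univalent function. *)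

theory Defs
  imports "HOL-Complex_Analysis.Complex_Analysis"
begin

text \<open>Wirtinger derivatives of a (real-)differentiable map u : C -> C at z,
  computed from its real Frechet derivative L: u_z = (L 1 - i L i)/2,
  u_zbar = (L 1 + i L i)/2, i.e. u_z = (u_x - i u_y)/2, u_zbar = (u_x + i u_y)/2.\<close>
definition wirtinger_z :: "(complex \<Rightarrow> complex) \<Rightarrow> complex \<Rightarrow> complex" where
  "wirtinger_z u z = (frechet_derivative u (at z) 1 - \<i> * frechet_derivative u (at z) \<i>) / 2"

definition wirtinger_zbar :: "(complex \<Rightarrow> complex) \<Rightarrow> complex \<Rightarrow> complex" where
  "wirtinger_zbar u z = (frechet_derivative u (at z) 1 + \<i> * frechet_derivative u (at z) \<i>) / 2"

definition jacobian_c :: "(complex \<Rightarrow> complex) \<Rightarrow> complex \<Rightarrow> real" where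
  "jacobian_c u z = (cmod (wirtinger_z u z))\<^sup>2 - (cmod (wirtinger_zbar u z))\<^sup>2"

definition sense_preserving :: "(complex \<Rightarrow> complex) \<Rightarrow> complex set \<Rightarrow> bool" where
  "sense_preserving u D \<longleftrightarrow>
     (\<forall>z\<in>D. u differentiable (at z)) \<and>
     continuous_on D (\<lambda>z. frechet_derivative u (at z)) \<and>
     (\<forall>z\<in>D. jacobian_c u z > 0)"

definition convex_of_order :: "real \<Rightarrow> (complex \<Rightarrow> complex) \<Rightarrow> bool" where
  "convex_of_order \<alpha> h \<longleftrightarrow>
     h holomorphic_on ball 0 1 \<and> h 0 = 0 \<and> deriv h 0 = 1 \<and>
     (\<forall>z\<in>ball 0 1. deriv h z \<noteq> 0) \<and>
     (\<forall>z\<in>ball 0 1. Re (1 + z * deriv (deriv h) z / deriv h z) > \<alpha>)"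

definition u_of :: "(complex \<Rightarrow> complex) \<Rightarrow> complex \<Rightarrow> complex" where
  "u_of h z = h z + (1/2) * complex_of_real (1 - (cmod z)\<^sup>2) * z * deriv h z"

end

theory Submission
  imports Defs
begin

text \<open>
  Put P(z) = 1 + z h''(z) / h'(z) and r = |z|. Then u_z = (h'/2) (2 - r^2 + (1 - r^2) P) and
  u_zbar = - z^2 h' / 2, so the Jacobian is positive as soon as (1 - r^2) Re P > - 2 (1 - r^2).
  For convex functions of order - 1/2 this is immediate. In the other cases, composing h with the
  disk automorphism that sends 0 to z turns a bound |f''(0)| <= C |f'(0)|, valid for all functions
  of the class, into (1 - r^2) Re P >= 1 + r^2 - C r.

  If f is injective with convex image, then phi(z) = f^(-1) ((f(z) + f(-z)) / 2) maps the disk into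
  itself and phi''(0) = f''(0) / f'(0), so C = 2 by Cauchy's inequality.

  If f is merely injective, C = 4 is Bieberbach's theorem. Instead of the area theorem we use
  that the logarithmic energy of a charge of total mass zero is nonnegative. Let
  k(z) = (z^2 / f(z^2))^(1/2) and put the charge cos t on the image of |z| = r under the univalent
  function k(z)/z. As |z - w| contributes the energy of the circle, and the logarithm of the
  quotient (w k(z) - z k(w)) / (w - z) is analytic in z and w, the energy can be computed by
  Cauchy's formula. Its sign gives r^2 Re k''(0) >= -2, which for r \<rightarrow> 1 says Re (f''(0) / f'(0)) <= 4.
\<close>

section \<open>Logarithmic energy\<close>

lemma continuous_on_prod_mult:
  fixes f g :: "real \<Rightarrow> real"
  assumes "continuous_on {a..b} f" "continuous_on {c..d} g"
  shows "continuous_on (cbox (a, c) (b, d)) (\<lambda>(t, s). f t * g s)"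
  unfolding case_prod_unfold cbox_Pair_eq
  by (intro continuous_intros continuous_on_compose2[OF assms(1)] continuous_on_compose2[OF assms(2)]) auto

lemma integral_prod_mult:
  fixes f g :: "real \<Rightarrow> real"
  assumes "continuous_on {a..b} f" "continuous_on {c..d} g"
  shows "integral (cbox (a, c) (b, d)) (\<lambda>(t, s). f t * g s) = integral {a..b} f * integral {c..d} g"
  by (subst integral_prod_continuous[OF continuous_on_prod_mult[OF assms]]) auto

lemma continuous_on_prod_inner:
  fixes V W :: "real \<Rightarrow> 'a :: real_inner"
  assumes "continuous_on {a..b} V" "continuous_on {c..d} W"
  shows "continuous_on (cbox (a, c) (b, d)) (\<lambda>(t, s). V t \<bullet> W s)"
  unfolding case_prod_unfold cbox_Pair_eq
  by (intro continuous_intros continuous_on_compose2[OF assms(1)] continuous_on_compose2[OF assms(2)]) auto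

text \<open>Schur's argument: one factor \<open>V t \<bullet> V s\<close> is expanded in
  coordinates, and each coordinate is absorbed into the weight as
  \<open>c t * (V t \<bullet> i)\<close>. The induction therefore ranges over all weights
  \<open>c\<close>; for \<open>n = 0\<close> the integral is the square of the integral of
  \<open>c\<close>.\<close>

lemma inner_power_kernel_nonneg:
  fixes V :: "real \<Rightarrow> 'a :: euclidean_space"
  assumes V: "continuous_on {a..b} V" and "continuous_on {a..b} c"
  shows "0 \<le> integral (cbox (a, a) (b, b)) (\<lambda>(t, s). c t * c s * (V t \<bullet> V s) ^ n)"
  using assms(2)
proof (induction n arbitrary: c)
  case 0
  then show ?case by (simp add: integral_prod_mult)
next
  case (Suc n)
  let ?B = "cbox (a, a) (b, b)"
  have ci: "continuous_on {a..b} (\<lambda>t. c t * (V t \<bullet> i))" for i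
    by (intro continuous_intros Suc.prems V)
  have cont: "continuous_on ?B (\<lambda>(t, s). (c t * (V t \<bullet> i)) * (c s * (V s \<bullet> i)) * (V t \<bullet> V s) ^ n)" for i
    using continuous_on_mult[OF continuous_on_prod_mult[OF ci[of i] ci[of i]]
        continuous_on_power[OF continuous_on_prod_inner[OF V V]]]
    by (simp add: case_prod_unfold)
  have "(\<lambda>(t, s). c t * c s * (V t \<bullet> V s) ^ Suc n) =
      (\<lambda>p. \<Sum>i\<in>Basis. (\<lambda>(t, s). (c t * (V t \<bullet> i)) * (c s * (V s \<bullet> i)) * (V t \<bullet> V s) ^ n) p)"
  proof (rule ext, clarify)
    fix t s
    have "c t * c s * (V t \<bullet> V s) ^ Suc n = c t * c s * (\<Sum>i\<in>Basis. (V t \<bullet> i) * (V s \<bullet> i)) * (V t \<bullet> V s) ^ n"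
      unfolding euclidean_inner[of "V t" "V s", symmetric] by simp
    then show "c t * c s * (V t \<bullet> V s) ^ Suc n =
        (\<Sum>i\<in>Basis. (c t * (V t \<bullet> i)) * (c s * (V s \<bullet> i)) * (V t \<bullet> V s) ^ n)"
      by (simp add: sum_distrib_left sum_distrib_right mult_ac)
  qed
  then have "integral ?B (\<lambda>(t, s). c t * c s * (V t \<bullet> V s) ^ Suc n) =
      (\<Sum>i\<in>Basis. integral ?B (\<lambda>(t, s). (c t * (V t \<bullet> i)) * (c s * (V s \<bullet> i)) * (V t \<bullet> V s) ^ n))"
    by (simp only:) (intro integral_sum integrable_continuous cont finite_Basis)
  also have "\<dots> \<ge> 0"
    by (intro sum_nonneg Suc.IH ci)
  finally show ?case .
qed

text \<open>The power series of -ln (1 - x) has nonnegative coefficients, so every term of the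
  expansion has the right sign by \<open>inner_power_kernel_nonneg\<close>. By compactness
  \<open>norm (V t)\<close> stays away from 1, which gives a geometric majorant for dominated
  convergence.\<close>

lemma ln_one_minus_inner_kernel_nonpos:
  fixes V :: "real \<Rightarrow> 'a :: euclidean_space"
  assumes V: "continuous_on {a..b} V" and c: "continuous_on {a..b} c"
    and less: "\<And>t. t \<in> {a..b} \<Longrightarrow> norm (V t) < 1"
  shows "integral (cbox (a, a) (b, b)) (\<lambda>(t, s). c t * c s * ln (1 - V t \<bullet> V s)) \<le> 0"
proof (cases "a \<le> b")
  case False
  then have "cbox (a, a) (b, b) = {}" by (auto simp: cbox_Pair_eq)
  then show ?thesis by simp
next
  case True
  let ?B = "cbox (a, a) (b, b)"
  \<comment> \<open>The term \<open>n = 0\<close> vanishes because division by zero gives 0, so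
    these are the partial sums of the logarithmic series.\<close>
  define f where "f m = (\<lambda>(t, s). \<Sum>n<m. - (c t * c s * (V t \<bullet> V s) ^ n) / real n)" for m :: nat
  obtain t0 where t0: "t0 \<in> {a..b}" "\<And>t. t \<in> {a..b} \<Longrightarrow> norm (V t) \<le> norm (V t0)"
    using continuous_attains_sup[of "{a..b}" "\<lambda>t. norm (V t)"] continuous_on_norm[OF V] True
    by auto
  define q where "q = (norm (V t0))\<^sup>2"
  have q: "0 \<le> q" "q < 1"
    using less[OF t0(1)] by (auto simp: q_def power_less_one_iff)
  obtain C where C: "\<And>t. t \<in> {a..b} \<Longrightarrow> \<bar>c t\<bar> \<le> C"
    using compact_imp_bounded[OF compact_continuous_image[OF c compact_Icc]]
    by (metis bounded_real imageI)
  have C0: "0 \<le> C" using C[of a] True by auto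
  have K: "\<bar>V t \<bullet> V s\<bar> \<le> q" if "t \<in> {a..b}" "s \<in> {a..b}" for t s
    using Cauchy_Schwarz_ineq2[of "V t" "V s"] mult_mono[OF t0(2)[OF that(1)] t0(2)[OF that(2)]]
    by (simp add: q_def power2_eq_square)
  have cont: "continuous_on ?B (\<lambda>(t, s). c t * c s * (V t \<bullet> V s) ^ n)" for n
    using continuous_on_mult[OF continuous_on_prod_mult[OF c c]
        continuous_on_power[OF continuous_on_prod_inner[OF V V]]]
    by (simp add: case_prod_unfold)
  have cont': "continuous_on ?B (\<lambda>p. - (\<lambda>(t, s). c t * c s * (V t \<bullet> V s) ^ n) p / real n)" for n
    using continuous_on_mult_right[OF cont[of n], of "- inverse (real n)"]
    by (simp add: divide_inverse mult_ac)
  have f_eq: "f m = (\<lambda>p. \<Sum>n<m. - (\<lambda>(t, s). c t * c s * (V t \<bullet> V s) ^ n) p / real n)" for m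
    by (auto simp: f_def)
  have f_int: "f m integrable_on ?B" for m
    unfolding f_eq by (intro integrable_continuous continuous_on_sum cont')
  have f_le: "integral ?B (f m) \<le> 0" for m
  proof -
    have "integral ?B (f m) = (\<Sum>n<m. integral ?B (\<lambda>p. - (\<lambda>(t, s). c t * c s * (V t \<bullet> V s) ^ n) p / real n))"
      unfolding f_eq by (intro integral_sum integrable_continuous cont') auto
    also have "\<dots> \<le> 0"
      by (intro sum_nonpos) (simp add: inner_power_kernel_nonneg[OF V c])
    finally show ?thesis .
  qed
  have dom: "norm (f m p) \<le> C * C * (1 / (1 - q))" if pB: "p \<in> ?B" for m p
  proof -
    obtain t s where p: "p = (t, s)" "t \<in> {a..b}" "s \<in> {a..b}"
      using pB by (cases p) (auto simp: cbox_Pair_eq)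
    have "\<bar>f m p\<bar> \<le> (\<Sum>n<m. \<bar>- (c t * c s * (V t \<bullet> V s) ^ n) / real n\<bar>)"
      unfolding f_def p(1) prod.case by (rule sum_abs)
    also have "\<dots> \<le> (\<Sum>n<m. C * C * q ^ n)"
    proof (rule sum_mono)
      fix n
      have "\<bar>- (c t * c s * (V t \<bullet> V s) ^ n) / real n\<bar> \<le> \<bar>c t * c s * (V t \<bullet> V s) ^ n\<bar>"
        using mult_left_mono[of 1 "real n" "\<bar>c t * c s * (V t \<bullet> V s) ^ n\<bar>"]
        by (cases "n = 0") (auto simp: divide_le_eq)
      also have "\<dots> \<le> C * C * q ^ n"
        unfolding abs_mult power_abs using p C C0 K q
        by (intro mult_mono power_mono) auto
      finally show "\<bar>- (c t * c s * (V t \<bullet> V s) ^ n) / real n\<bar> \<le> C * C * q ^ n" .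
    qed
    also have "\<dots> = C * C * (\<Sum>n<m. q ^ n)"
      by (simp add: sum_distrib_left)
    also have "\<dots> \<le> C * C * (1 / (1 - q))"
      using q C0 by (intro mult_left_mono) (auto simp: sum_gp_strict divide_simps)
    finally show ?thesis by simp
  qed
  have lim: "(\<lambda>m. f m p) \<longlonglongrightarrow> (\<lambda>(t, s). c t * c s * ln (1 - V t \<bullet> V s)) p" if pB: "p \<in> ?B" for p
  proof -
    obtain t s where p: "p = (t, s)" "t \<in> {a..b}" "s \<in> {a..b}"
      using pB by (cases p) (auto simp: cbox_Pair_eq)
    have "\<bar>- (V t \<bullet> V s)\<bar> < 1"
      using K[OF p(2,3)] q by simp
    from sums_mult[OF ln_series'[OF this], of "c t * c s"] show ?thesis
      by (simp add: f_def p(1) sums_def mult_ac)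
  qed
  have "(\<lambda>m. integral ?B (f m)) \<longlonglongrightarrow> integral ?B (\<lambda>(t, s). c t * c s * ln (1 - V t \<bullet> V s))"
    by (rule dominated_convergence(2)[OF f_int _ dom lim]) (auto intro: integrable_const)
  then show ?thesis
    using f_le by (intro LIMSEQ_le_const2) auto
qed

text \<open>
  The vector V below is the inverse stereographic projection of x, shrunk slightly because of
  \<epsilon>; up to factors depending on t or s only, |x t - x s|^2 + \<epsilon> is 1 - V t \<bullet> V s.
\<close>
lemma log_energy_nonpos:
  fixes x :: "real \<Rightarrow> complex"
  assumes x: "continuous_on {a..b} x" and c: "continuous_on {a..b} c"
    and mean: "integral {a..b} c = 0" and \<epsilon>: "\<epsilon> > 0"
  shows "integral (cbox (a, a) (b, b)) (\<lambda>(t, s). c t * c s * ln ((cmod (x t - x s))\<^sup>2 + \<epsilon>)) \<le> 0"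
proof -
  let ?B = "cbox (a, a) (b, b)"
  \<comment> \<open>Half of \<open>\<epsilon>\<close> goes to each variable, so
    \<open>p t + p s\<close> contributes the whole \<open>\<epsilon>\<close> in \<open>key\<close>.
    For t = s the same identity shows that V lies strictly inside the unit ball.\<close>
  define p where "p t = (cmod (x t))\<^sup>2 + \<epsilon> / 2" for t
  define V where "V t = (1 / (1 + p t)) *\<^sub>R (sqrt 2 *\<^sub>R x t, 1 :: real, p t)" for t
  have p: "p t > 0" for t
    using \<epsilon> by (simp add: p_def add_nonneg_pos)
  then have p1: "1 + p t > 0" "1 + p t \<noteq> 0" for t
    by (smt (verit))+
  have contp: "continuous_on {a..b} p"
    unfolding p_def by (intro continuous_intros x)
  have contV: "continuous_on {a..b} V"
    unfolding V_def by (intro continuous_intros contp x) (use p1 in auto)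
  have contl: "continuous_on {a..b} (\<lambda>t. c t * ln (1 + p t))"
    by (intro continuous_intros c contp) (use p1 in auto)
  have inner: "V t \<bullet> V s = (2 * (x t \<bullet> x s) + 1 + p t * p s) / ((1 + p t) * (1 + p s))" for t s
    by (simp add: V_def add_divide_distrib mult_ac flip: mult.assoc)
  have key: "(cmod (x t - x s))\<^sup>2 + \<epsilon> = (1 + p t) * (1 + p s) * (1 - V t \<bullet> V s)" for t s
  proof -
    have "(1 + p t) * (1 + p s) * (1 - V t \<bullet> V s) = (1 + p t) * (1 + p s) - (2 * (x t \<bullet> x s) + 1 + p t * p s)"
      unfolding inner right_diff_distrib using p1(2)[of t] p1(2)[of s] by simp
    also have "\<dots> = (cmod (x t))\<^sup>2 + (cmod (x s))\<^sup>2 - 2 * (x t \<bullet> x s) + \<epsilon>"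
      by (simp add: p_def field_simps)
    also have "\<dots> = (cmod (x t - x s))\<^sup>2 + \<epsilon>"
      by (simp add: power2_norm_eq_inner inner_diff inner_commute)
    finally show ?thesis by simp
  qed
  have less: "norm (V t) < 1" for t
  proof -
    have "\<epsilon> = (1 + p t) * (1 + p t) * (1 - V t \<bullet> V t)"
      using key[of t t] by simp
    then have "1 - V t \<bullet> V t > 0"
      using \<epsilon> p1(1)[of t] by (metis mult_pos_pos zero_less_mult_pos)
    then have "(norm (V t))\<^sup>2 < 1"
      by (simp add: power2_norm_eq_inner)
    then show ?thesis
      by (simp add: power_less_one_iff abs_square_less_1)
  qed
  have pos: "1 - V t \<bullet> V s > 0" for t s
  proof -
    have "V t \<bullet> V s \<le> norm (V t) * norm (V s)"
      by (rule norm_cauchy_schwarz)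
    also have "\<dots> < 1"
      using mult_strict_mono[OF less[of t] less[of s]] by simp
    finally show ?thesis by simp
  qed
  have split: "c t * c s * ln ((cmod (x t - x s))\<^sup>2 + \<epsilon>) =
      (c t * ln (1 + p t)) * c s + c t * (c s * ln (1 + p s)) + c t * c s * ln (1 - V t \<bullet> V s)" for t s
  proof -
    have "ln ((cmod (x t - x s))\<^sup>2 + \<epsilon>) = ln (1 + p t) + ln (1 + p s) + ln (1 - V t \<bullet> V s)"
      unfolding key using pos[of t s] p1[of t] p1[of s] by (simp only: ln_mult_pos mult_pos_pos)
    then show ?thesis by (simp add: algebra_simps)
  qed
  have i1: "(\<lambda>(t, s). (c t * ln (1 + p t)) * c s) integrable_on ?B"
    by (intro integrable_continuous continuous_on_prod_mult contl c)
  have i2: "(\<lambda>(t, s). c t * (c s * ln (1 + p s))) integrable_on ?B"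
    by (intro integrable_continuous continuous_on_prod_mult contl c)
  have "continuous_on ?B (\<lambda>q. (\<lambda>(t, s). c t * c s) q * ln (1 - (\<lambda>(t, s). V t \<bullet> V s) q))"
    by (intro continuous_intros continuous_on_prod_mult continuous_on_prod_inner c contV)
       (use pos in \<open>auto simp: less_imp_neq[symmetric] dest: less_imp_neq\<close>)
  then have i3: "(\<lambda>(t, s). c t * c s * ln (1 - V t \<bullet> V s)) integrable_on ?B"
    by (intro integrable_continuous) (simp add: case_prod_unfold)
  have "integral ?B (\<lambda>(t, s). c t * c s * ln ((cmod (x t - x s))\<^sup>2 + \<epsilon>)) =
     integral ?B (\<lambda>q. (\<lambda>(t, s). (c t * ln (1 + p t)) * c s) q + (\<lambda>(t, s). c t * (c s * ln (1 + p s))) q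
       + (\<lambda>(t, s). c t * c s * ln (1 - V t \<bullet> V s)) q)"
    by (simp add: case_prod_unfold split)
  also have "\<dots> = integral ?B (\<lambda>(t, s). (c t * ln (1 + p t)) * c s) +
      integral ?B (\<lambda>(t, s). c t * (c s * ln (1 + p s))) +
      integral ?B (\<lambda>(t, s). c t * c s * ln (1 - V t \<bullet> V s))"
    by (subst integral_add[OF integrable_add[OF i1 i2] i3], subst integral_add[OF i1 i2]) simp
  \<comment> \<open>The first two integrals factor, and each has the total mass of \<open>c\<close>
    as a factor, which is zero.\<close>
  also have "\<dots> = integral ?B (\<lambda>(t, s). c t * c s * ln (1 - V t \<bullet> V s))"
    unfolding integral_prod_mult[OF contl c] integral_prod_mult[OF c contl] mean by simp
  also have "\<dots> \<le> 0"
    by (rule ln_one_minus_inner_kernel_nonpos[OF contV c less])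
  finally show ?thesis .
qed

section \<open>Integrals over circles\<close>

lemma circle_mean_value:
  fixes F :: "complex \<Rightarrow> complex"
  assumes F: "F holomorphic_on ball 0 1" and r: "0 < r" "r < 1"
  shows "((\<lambda>t. F (of_real r * cis t)) has_integral 2 * of_real pi * F 0) {0..2*pi}"
proof -
  have "F holomorphic_on cball 0 r"
    using F r by (auto intro: holomorphic_on_subset)
  then have "((\<lambda>u. F u / (u - 0)) has_contour_integral (2 * of_real pi * \<i> * F 0)) (part_circlepath 0 r 0 (2*pi))"
    using Cauchy_integral_circlepath_simple[of F 0 r 0] r by (simp add: circlepath_def)
  then have "((\<lambda>t. F (of_real r * cis t) * \<i>) has_integral (2 * of_real pi * \<i> * F 0)) {0..2*pi}"
    using r by (subst (asm) has_contour_integral_part_circlepath_iff) (auto simp: divide_simps cong: has_integral_cong)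
  from has_integral_mult_left[OF this, of "-\<i>"] show ?thesis
    by (simp add: mult_ac)
qed

lemma circle_first_coefficient:
  fixes F :: "complex \<Rightarrow> complex"
  assumes F: "F holomorphic_on ball 0 1" and r: "0 < r" "r < 1"
  shows "((\<lambda>t. F (of_real r * cis t) * cis (- t)) has_integral 2 * of_real pi * of_real r * deriv F 0) {0..2*pi}"
proof -
  have F': "continuous_on (cball 0 r) F" "F holomorphic_on ball 0 r"
    using F r by (auto intro!: holomorphic_on_imp_continuous_on intro: holomorphic_on_subset)
  have "((\<lambda>u. F u / (u - 0)\<^sup>2) has_contour_integral (2 * of_real pi * \<i> * deriv F 0)) (circlepath 0 r)"
    using has_contour_integral_integral[OF Cauchy_derivative_integral_circlepath(1)[OF F', of 0]]
      Cauchy_contour_integral_circlepath_2[OF F', of 0] r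
    by simp
  then have "((\<lambda>t. F (of_real r * cis t) / (of_real r * cis t)\<^sup>2 * of_real r * \<i> * cis t)
      has_integral (2 * of_real pi * \<i> * deriv F 0)) {0..2*pi}"
    unfolding circlepath_def by (subst (asm) has_contour_integral_part_circlepath_iff) auto
  from has_integral_mult_left[OF this, of "- \<i> * of_real r"]
  have "((\<lambda>t. F (of_real r * cis t) / (of_real r * cis t)\<^sup>2 * of_real r * \<i> * cis t * (- \<i> * of_real r))
      has_integral 2 * of_real pi * of_real r * deriv F 0) {0..2*pi}"
    by (simp add: mult_ac)
  moreover have "F (of_real r * cis t) / (of_real r * cis t)\<^sup>2 * of_real r * \<i> * cis t * (- \<i> * of_real r)
      = F (of_real r * cis t) * cis (- t)" for t
    using r by (simp add: field_simps power2_eq_square cis_mult flip: cis_inverse)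
  ultimately show ?thesis by simp
qed

text \<open>Write 2 cos t = e^(it) + e^(-it). The first part integrates to zero, being the mean
  value of z F(z) up to a constant; the second picks out the first Taylor coefficient.\<close>

lemma Re_circle_cos_integral:
  fixes F :: "complex \<Rightarrow> complex"
  assumes F: "F holomorphic_on ball 0 1" and r: "0 < r" "r < 1"
  shows "((\<lambda>t. cos t * Re (F (of_real r * cis t))) has_integral pi * r * Re (deriv F 0)) {0..2*pi}"
proof -
  have "(\<lambda>z. z * F z / of_real r) holomorphic_on ball 0 1"
    using r by (intro holomorphic_intros F) auto
  from circle_mean_value[OF this r]
  have "((\<lambda>t. cis t * F (of_real r * cis t)) has_integral 0) {0..2*pi}"
    using r by simp
  from has_integral_add[OF this circle_first_coefficient[OF F r]]
  have "((\<lambda>t. cis t * F (of_real r * cis t) + F (of_real r * cis t) * cis (- t))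
      has_integral 2 * of_real pi * of_real r * deriv F 0) {0..2*pi}" by simp
  from has_integral_linear[OF this bounded_linear_Re]
  have "((\<lambda>t. 2 * (cos t * Re (F (of_real r * cis t)))) has_integral 2 * pi * r * Re (deriv F 0)) {0..2*pi}"
    by (simp add: o_def)
  from has_integral_mult_right[OF this, of "1/2"] show ?thesis
    by (simp add: mult_ac)
qed

section \<open>Integrals of the regularised chord\<close>

text \<open>This choice of the regularising constant turns the squared chord into the squared
  modulus of a function that is analytic and zero-free in w = \<rho> e^(is). Its logarithm and its
  reciprocal can then be integrated in closed form.\<close>

lemma regularized_chord:
  assumes "\<rho> > 0"
  shows "(cmod (cis t - cis s))\<^sup>2 + (1 - \<rho>)\<^sup>2 / \<rho> = (cmod (1 - cis (- t) * (of_real \<rho> * cis s)))\<^sup>2 / \<rho>"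
proof -
  have t: "(sin t)\<^sup>2 = 1 - (cos t)\<^sup>2" and s: "(sin s)\<^sup>2 = 1 - (cos s)\<^sup>2"
    by (simp_all add: sin_squared_eq)
  have eq: "1 - cis (- t) * (of_real \<rho> * cis s) = cis (- t) * (cis t - of_real \<rho> * cis s)"
    by (simp add: algebra_simps cis_mult)
  have "(cmod (1 - cis (- t) * (of_real \<rho> * cis s)))\<^sup>2 = (cmod (cis t - of_real \<rho> * cis s))\<^sup>2"
    unfolding eq norm_mult by simp
  also have "\<dots> = 1 + \<rho>\<^sup>2 - 2 * \<rho> * (cos t * cos s + sin t * sin s)"
    unfolding cmod_power2 by (simp add: power2_diff power_mult_distrib t s algebra_simps)
  also have "\<dots> = \<rho> * ((cmod (cis t - cis s))\<^sup>2 + (1 - \<rho>)\<^sup>2 / \<rho>)"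
    unfolding cmod_power2 using assms
    by (simp add: power2_diff t s algebra_simps) (simp add: field_simps power2_eq_square)
  finally show ?thesis using assms by simp
qed

lemma one_minus_cis_mult_nonzero:
  assumes "cmod z < 1"
  shows "1 - cis t * z \<noteq> 0"
  using assms by (metis eq_iff_diff_eq_0 less_irrefl mult_1 norm_cis norm_mult norm_one)

text \<open>The logarithm is 2 Re Ln (1 - e^(-it) w) - ln \<rho> with w = \<rho> e^(is). The
  constant drops out because cos has mean zero, and the first Taylor coefficient of the analytic
  part is -e^(-it).\<close>

lemma cos_ln_chord_integral:
  assumes \<rho>: "0 < \<rho>" "\<rho> < 1"
  shows "((\<lambda>s. cos s * ln ((cmod (cis t - cis s))\<^sup>2 + (1 - \<rho>)\<^sup>2 / \<rho>)) has_integral - 2 * pi * \<rho> * cos t) {0..2*pi}"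
proof -
  define F where "F z = Ln (1 - cis (- t) * z)" for z
  have Re: "Re (1 - cis (- t) * z) > 0" if "cmod z < 1" for z
    using complex_Re_le_cmod[of "cis (- t) * z"] that by (simp add: norm_mult del: times_complex.sel)
  have nz: "1 - cis (- t) * z \<notin> \<real>\<^sub>\<le>\<^sub>0" if "cmod z < 1" for z
    using Re[OF that] by (auto simp: complex_nonpos_Reals_iff simp del: minus_complex.sel times_complex.sel)
  have F: "F holomorphic_on ball 0 1"
    unfolding F_def by (intro holomorphic_intros) (use nz in auto)
  have "(F has_field_derivative - cis (- t)) (at 0)"
    unfolding F_def by (auto intro!: derivative_eq_intros)
  then have dF: "deriv F 0 = - cis (- t)"
    by (rule DERIV_imp_deriv)
  have 1: "((\<lambda>s. cos s * Re (F (of_real \<rho> * cis s))) has_integral - pi * \<rho> * cos t) {0..2*pi}"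
    using Re_circle_cos_integral[OF F \<rho>] by (simp add: dF)
  have 2: "((\<lambda>s. cos s) has_integral 0) {0..2*pi}"
    using Re_circle_cos_integral[OF holomorphic_on_const \<rho>, of 1] by simp
  have "((\<lambda>s. 2 * (cos s * Re (F (of_real \<rho> * cis s))) - cos s * ln \<rho>) has_integral 2 * (- pi * \<rho> * cos t) - 0 * ln \<rho>) {0..2*pi}"
    by (intro has_integral_diff has_integral_mult_right has_integral_mult_left 1 2)
  moreover have "cos s * ln ((cmod (cis t - cis s))\<^sup>2 + (1 - \<rho>)\<^sup>2 / \<rho>) =
      2 * (cos s * Re (F (of_real \<rho> * cis s))) - cos s * ln \<rho>" for s
  proof -
    have "1 - cis (- t) * (of_real \<rho> * cis s) \<noteq> 0"
      using \<rho> by (intro one_minus_cis_mult_nonzero) (simp add: norm_mult)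
    then have "ln ((cmod (1 - cis (- t) * (of_real \<rho> * cis s)))\<^sup>2 / \<rho>) = 2 * Re (F (of_real \<rho> * cis s)) - ln \<rho>"
      unfolding F_def using \<rho> by (simp add: ln_div ln_realpow)
    then show ?thesis
      unfolding regularized_chord[OF \<rho>(1)] by (simp add: right_diff_distrib)
  qed
  ultimately show ?thesis by (simp add: mult_ac)
qed

text \<open>Up to a constant the integrand is the Poisson kernel Re ((1 + w) / (1 - w)), which has
  mean 1. It controls the error made by the regularisation.\<close>

lemma poisson_chord_integral:
  assumes \<rho>: "0 < \<rho>" "\<rho> < 1"
  shows "((\<lambda>s. 1 / ((cmod (cis t - cis s))\<^sup>2 + (1 - \<rho>)\<^sup>2 / \<rho>)) has_integral 2 * pi * \<rho> / (1 - \<rho>\<^sup>2)) {0..2*pi}"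
proof -
  define F where "F z = (1 + cis (- t) * z) / (1 - cis (- t) * z)" for z
  have F: "F holomorphic_on ball 0 1"
    unfolding F_def by (intro holomorphic_intros) (use one_minus_cis_mult_nonzero in auto)
  have \<rho>1: "\<rho>\<^sup>2 < 1" using \<rho> by (simp add: power_less_one_iff)
  have "((\<lambda>s. Re (F (of_real \<rho> * cis s))) has_integral 2 * pi) {0..2*pi}"
    using has_integral_linear[OF circle_mean_value[OF F \<rho>] bounded_linear_Re] by (simp add: F_def o_def)
  from has_integral_mult_right[OF this, of "\<rho> / (1 - \<rho>\<^sup>2)"]
  have "((\<lambda>s. \<rho> / (1 - \<rho>\<^sup>2) * Re (F (of_real \<rho> * cis s))) has_integral 2 * pi * \<rho> / (1 - \<rho>\<^sup>2)) {0..2*pi}"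
    by (simp add: mult_ac)
  moreover have "1 / ((cmod (cis t - cis s))\<^sup>2 + (1 - \<rho>)\<^sup>2 / \<rho>) = \<rho> / (1 - \<rho>\<^sup>2) * Re (F (of_real \<rho> * cis s))" for s
  proof -
    define w where "w = cis (- t) * (of_real \<rho> * cis s)"
    have w: "cmod w = \<rho>" using \<rho> by (simp add: w_def norm_mult)
    have "Re ((1 + w) / (1 - w)) = (1 - (cmod w)\<^sup>2) / (cmod (1 - w))\<^sup>2"
      unfolding Re_divide' cmod_power2 by (simp add: power2_eq_square algebra_simps)
    then have "Re (F (of_real \<rho> * cis s)) = (1 - \<rho>\<^sup>2) / (cmod (1 - w))\<^sup>2"
      unfolding F_def w_def[symmetric] w .
    then show ?thesis
      unfolding regularized_chord[OF \<rho>(1)] w_def[symmetric] using \<rho>1 by simp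
  qed
  ultimately show ?thesis by simp
qed

section \<open>Difference quotients\<close>

definition diff_quot :: "(complex \<Rightarrow> complex) \<Rightarrow> complex \<Rightarrow> complex \<Rightarrow> complex" where
  "diff_quot f z w = (if z = w then deriv f z else (f z - f w) / (z - w))"

lemma diff_quot_commute: "diff_quot f z w = diff_quot f w z"
  using minus_divide_divide[of "f z - f w" "z - w"] by (simp add: diff_quot_def)

lemma diff_quot_mult: "(z - w) * diff_quot f z w = f z - f w"
  by (simp add: diff_quot_def)

text \<open>The factor \<open>f z - z * diff_quot f z w\<close> is the difference quotient of f(z)/z
  with respect to 1/z, written so that it makes sense also for z = w and at 0.\<close>

lemma diff_quot_kernel_mult: "(w - z) * (f z - z * diff_quot f z w) = w * f z - z * f w"
proof -
  have "(w - z) * (f z - z * diff_quot f z w) = (w - z) * f z + z * ((z - w) * diff_quot f z w)"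
    by (simp only: algebra_simps)
  then show ?thesis
    unfolding diff_quot_mult by (simp add: algebra_simps)
qed

text \<open>Hadamard's formula. It covers z = w as well, where the path is constant, and so reduces
  joint continuity in (z, w) to continuity of a parameter integral.\<close>

lemma diff_quot_eq_integral:
  assumes f: "f holomorphic_on S" and S: "open S" "convex S" and zw: "z \<in> S" "w \<in> S"
  shows "diff_quot f z w = integral {0..1} (\<lambda>t. deriv f (linepath w z t))"
proof (cases "z = w")
  case True
  then show ?thesis by (simp add: diff_quot_def linepath_refl)
next
  case False
  have "(f has_field_derivative deriv f x) (at x within S)" if "x \<in> S" for x
    using f S(1) that by (rule holomorphic_derivI)
  moreover have "path_image (linepath w z) \<subseteq> S"
    using S(2) zw by (simp add: closed_segment_subset)
  ultimately have "(deriv f has_contour_integral (f z - f w)) (linepath w z)"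
    using contour_integral_primitive[of S f "deriv f" "linepath w z"] by simp
  then have "((\<lambda>t. deriv f (linepath w z t) * (z - w)) has_integral (f z - f w)) {0..1}"
    by (simp add: has_contour_integral_linepath)
  from has_integral_mult_left[OF this, of "inverse (z - w)"]
  have "((\<lambda>t. deriv f (linepath w z t)) has_integral (f z - f w) / (z - w)) {0..1}"
    using False by (simp add: divide_inverse mult.assoc)
  then show ?thesis
    using False by (simp add: diff_quot_def integral_unique)
qed

lemma continuous_on_diff_quot:
  assumes f: "f holomorphic_on S" and S: "open S" "convex S"
  shows "continuous_on (S \<times> S) (\<lambda>(z, w). diff_quot f z w)"
proof -
  have *: "continuous_on S (deriv f)"
    using f S(1) by (intro holomorphic_on_imp_continuous_on holomorphic_deriv)
  have "linepath w z t \<in> S" if "z \<in> S" "w \<in> S" "t \<in> {0..1}" for z w t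
    using that S(2) by (metis closed_segment_subset linepath_in_path subsetD)
  then have "continuous_on ((S \<times> S) \<times> cbox 0 1) (\<lambda>(p, t). deriv f (linepath (snd p) (fst p) t))"
    unfolding case_prod_unfold
    by (intro continuous_on_compose2[OF *]) (auto simp: linepath_def intro!: continuous_intros)
  then have "continuous_on (S \<times> S) (\<lambda>p. integral (cbox 0 1) (\<lambda>t. deriv f (linepath (snd p) (fst p) t)))"
    by (rule integral_continuous_on_param)
  then show ?thesis
    by (rule continuous_on_eq) (auto simp: diff_quot_eq_integral[OF assms])
qed

lemma holomorphic_on_diff_quot:
  assumes f: "f holomorphic_on S" and S: "open S" "convex S" and z: "z \<in> S"
  shows "diff_quot f z holomorphic_on S"
proof (rule no_isolated_singularity[OF _ _ S(1), of _ "{z}"])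
  show "continuous_on S (diff_quot f z)"
    using continuous_on_compose2[OF continuous_on_diff_quot[OF f S], of S "\<lambda>w. (z, w)"] z
    by (auto simp: continuous_on_Pair[OF continuous_on_const continuous_on_id])
  have "(\<lambda>w. (f z - f w) / (z - w)) holomorphic_on S - {z}"
    by (intro holomorphic_intros holomorphic_on_subset[OF f]) auto
  then show "diff_quot f z holomorphic_on S - {z}"
    by (rule holomorphic_transform) (auto simp: diff_quot_def)
qed auto

text \<open>With q = \<open>diff_quot f z\<close>, differentiate f(w) = f(z) + (w - z) q(w) twice;
  at w = z the term with q'' is killed by the factor w - z, leaving f''(z) = 2 q'(z).\<close>

lemma deriv_diff_quot_diagonal:
  assumes f: "f holomorphic_on S" and S: "open S" "convex S" and z: "z \<in> S"
  shows "deriv (diff_quot f z) z = deriv (deriv f) z / 2"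
proof -
  define q where "q = diff_quot f z"
  have q: "q holomorphic_on S"
    unfolding q_def by (rule holomorphic_on_diff_quot[OF assms])
  have f_eq: "f w = f z + (w - z) * q w" for w
    using diff_quot_mult[of z w f] unfolding q_def by (simp add: algebra_simps)
  have dq: "(q has_field_derivative deriv q w) (at w)" "(deriv q has_field_derivative deriv (deriv q) w) (at w)"
    if "w \<in> S" for w
    using q S(1) that by (auto intro!: holomorphic_derivI holomorphic_deriv)
  have df: "deriv f w = q w + (w - z) * deriv q w" if "w \<in> S" for w
  proof (rule DERIV_imp_deriv)
    have "((\<lambda>w. f z + (w - z) * q w) has_field_derivative q w + (w - z) * deriv q w) (at w)"
      by (auto intro!: derivative_eq_intros dq that)
    then show "(f has_field_derivative q w + (w - z) * deriv q w) (at w)"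
      by (simp only: f_eq[symmetric])
  qed
  have "((\<lambda>w. q w + (w - z) * deriv q w) has_field_derivative 2 * deriv q z) (at z)"
    by (auto intro!: derivative_eq_intros dq z)
  then have "(deriv f has_field_derivative 2 * deriv q z) (at z)"
    by (rule has_field_derivative_transform_within_open[OF _ S(1) z]) (simp add: df)
  then show ?thesis
    unfolding q_def[symmetric] by (simp add: DERIV_imp_deriv)
qed

section \<open>Error of regularising only one factor in the logarithm of a product\<close>

text \<open>Both ln y and -ln y are estimated by ln x \<le> x - 1, where y = (d Q + e) / (Q (d +
  e)). The factor e / (d + e) is kept in the bound: for the chord it is a multiple of the Poisson
  kernel, and its integral tends to 0 as \<rho> tends to 1.\<close>

lemma ln_regularization_error:
  fixes d e m M Q :: real
  assumes "0 \<le> d" "0 < e" "0 < m" "m \<le> Q" "Q \<le> M"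
  shows "\<bar>ln (d * Q + e) - ln (d + e) - ln Q\<bar> \<le> (1 / m + M) * (e * (1 / (d + e)))"
proof -
  have pos: "Q > 0" "d + e > 0" "d * Q + e > 0" "M > 0"
    using assms by (auto simp: add_nonneg_pos)
  define y where "y = (d * Q + e) / (Q * (d + e))"
  have y: "y > 0" unfolding y_def using pos by simp
  have eq: "ln (d * Q + e) - ln (d + e) - ln Q = ln y"
    unfolding y_def using pos by (simp add: ln_div ln_mult)
  have "ln y \<le> y - 1" using y by (rule ln_le_minus_one)
  also have "y - 1 = (e / (d + e)) * ((1 - Q) / Q)"
    unfolding y_def using pos by (simp add: divide_simps) (simp add: algebra_simps)
  also have "\<dots> \<le> (e / (d + e)) * (1 / m + M)"
  proof (intro mult_left_mono)
    have "(1 - Q) / Q \<le> 1 / Q" using pos by (simp add: divide_simps)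
    also have "\<dots> \<le> 1 / m" using assms by (simp add: frac_le)
    finally show "(1 - Q) / Q \<le> 1 / m + M" using pos by simp
  qed (use pos assms in auto)
  finally have 1: "ln y \<le> (e / (d + e)) * (1 / m + M)" .
  have "- ln y = ln (1 / y)" using y by (simp add: ln_div)
  also have "\<dots> \<le> 1 / y - 1" using y by (intro ln_le_minus_one) simp
  also have "1 / y - 1 = e * (Q - 1) / (d * Q + e)"
    unfolding y_def using pos by (simp add: field_simps)
  also have "\<dots> \<le> (e / (d + e)) * (1 / m + M)"
  proof (cases "Q \<le> 1")
    case True
    then have "e * (Q - 1) / (d * Q + e) \<le> 0"
      using pos assms by (simp add: divide_nonpos_pos mult_nonneg_nonpos)
    also have "0 \<le> (e / (d + e)) * (1 / m + M)" using pos assms by simp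
    finally show ?thesis .
  next
    case False
    then have "d * 1 \<le> d * Q" using assms by (intro mult_left_mono) auto
    then have "e * (Q - 1) / (d * Q + e) \<le> e * (Q - 1) / (d + e)"
      using False pos assms by (intro divide_left_mono) auto
    also have "\<dots> = (e / (d + e)) * (Q - 1)" by simp
    also have "\<dots> \<le> (e / (d + e)) * (1 / m + M)"
      using pos assms by (intro mult_left_mono) (auto intro: order_trans[of _ M] simp: add_increasing)
    finally show ?thesis .
  qed
  finally have "- ln y \<le> (e / (d + e)) * (1 / m + M)" .
  with 1 show ?thesis unfolding eq by (simp add: abs_le_iff mult.commute)
qed

section \<open>Coefficient bounds\<close>

text \<open>As a function of w the kernel is analytic and zero-free, hence exp G with G analytic,
  and the integrand is 2 cos s Re G. Since the kernel equals 1 at w = 0, G'(0) is just its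
  derivative there.\<close>

lemma cos_ln_kernel_integral:
  assumes k: "k holomorphic_on ball 0 1" and k0: "k 0 = 1"
    and nz: "\<And>w. w \<in> ball 0 1 \<Longrightarrow> k z - z * diff_quot k z w \<noteq> 0"
    and z: "z \<in> ball 0 1" "z \<noteq> 0" and r: "0 < r" "r < 1"
  shows "((\<lambda>s. cos s * ln ((cmod (k z - z * diff_quot k z (of_real r * cis s)))\<^sup>2)) has_integral
    2 * pi * r * Re (deriv k 0 - diff_quot k 0 z)) {0..2*pi}"
proof -
  define \<Phi> where "\<Phi> w = k z - z * diff_quot k z w" for w
  have hol: "\<Phi> holomorphic_on ball 0 1"
    unfolding \<Phi>_def using z by (intro holomorphic_intros holomorphic_on_diff_quot k) auto
  have dk: "(k has_field_derivative deriv k 0) (at 0)"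
    by (rule holomorphic_derivI[OF k]) auto
  have "((\<lambda>w. k z - z * ((k z - k w) / (z - w))) has_field_derivative deriv k 0 - diff_quot k 0 z) (at 0)"
    using z(2) by (auto intro!: derivative_eq_intros dk simp: diff_quot_commute[of k 0 z] diff_quot_def)
       (simp add: k0 field_simps)
  \<comment> \<open>The explicit quotient agrees with \<open>diff_quot\<close> on the open set
    \<open>- {z}\<close>, which contains 0 because z is nonzero.\<close>
  then have "(\<Phi> has_field_derivative deriv k 0 - diff_quot k 0 z) (at 0)"
    by (rule has_field_derivative_transform_within_open[of _ _ _ "- {z}"])
       (use z in \<open>auto simp: \<Phi>_def diff_quot_def\<close>)
  moreover have "\<Phi> 0 = 1"
    using diff_quot_mult[of z 0 k] by (simp add: \<Phi>_def k0)
  moreover obtain G where G: "G holomorphic_on ball 0 1" "\<And>w. w \<in> ball 0 1 \<Longrightarrow> exp (G w) = \<Phi> w"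
    using holomorphic_logarithm_exists[OF convex_ball open_ball hol, of 0] nz unfolding \<Phi>_def by auto
  moreover have "(G has_field_derivative deriv G 0) (at 0)"
    by (rule holomorphic_derivI[OF G(1)]) auto
  then have "((\<lambda>w. exp (G w)) has_field_derivative exp (G 0) * deriv G 0) (at 0)"
    by (auto intro!: derivative_eq_intros)
  then have "(\<Phi> has_field_derivative exp (G 0) * deriv G 0) (at 0)"
    by (rule has_field_derivative_transform_within_open[of _ _ _ "ball 0 1"]) (use G in auto)
  ultimately have dG: "deriv G 0 = deriv k 0 - diff_quot k 0 z"
    using DERIV_unique G(2)[of 0] by fastforce
  have "ln ((cmod (\<Phi> (of_real r * cis s)))\<^sup>2) = 2 * Re (G (of_real r * cis s))" for s
    using r by (subst G(2)[symmetric]) (simp_all add: norm_mult ln_realpow)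
  then have eq: "cos s * ln ((cmod (k z - z * diff_quot k z (of_real r * cis s)))\<^sup>2) =
      2 * (cos s * Re (G (of_real r * cis s)))" for s
    unfolding \<Phi>_def by simp
  have "((\<lambda>s. 2 * (cos s * Re (G (of_real r * cis s)))) has_integral
      2 * (pi * r * Re (deriv G 0))) {0..2*pi}"
    by (intro has_integral_mult_right Re_circle_cos_integral G r)
  then show ?thesis
    unfolding eq by (simp only: dG mult.assoc)
qed

text \<open>The curve \<open>x\<close> is r times the image of |z| = r under k(z)/z. Squared
  distances on it factor into the squared chord \<open>d\<close> and the kernel \<open>Q\<close>. As
  \<rho> tends to 1, the part from \<open>d\<close> tends to -2 pi^2, and the part from
  \<open>Q\<close> is -pi^2 r^2 Re k''(0); by \<open>log_energy_nonpos\<close> their sum is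
  nonpositive in the limit.\<close>

lemma radius_sq_Re_deriv2_ge_if_kernel_nonzero:
  assumes k: "k holomorphic_on ball 0 1" and k0: "k 0 = 1"
    and nz: "\<And>z w. z \<in> ball 0 1 \<Longrightarrow> w \<in> ball 0 1 \<Longrightarrow> k z - z * diff_quot k z w \<noteq> 0"
    and r: "0 < r" "r < 1"
  shows "- 2 \<le> r\<^sup>2 * Re (deriv (deriv k) 0)"
proof -
  let ?B = "cbox (0, 0) (2*pi, 2*pi)"
  define Z where "Z t = of_real r * cis t" for t
  have Z: "Z t \<in> ball 0 1" "Z t \<noteq> 0" for t
    using r by (auto simp: Z_def norm_mult)
  have contZ: "continuous_on A Z" for A
    unfolding Z_def cis_conv_exp by (intro continuous_intros)
  define Q where "Q t s = (cmod (k (Z t) - Z t * diff_quot k (Z t) (Z s)))\<^sup>2" for t s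
  define d where "d t s = (cmod (cis t - cis s))\<^sup>2" for t s
  define x where "x t = cis (- t) * k (Z t)" for t
  have Qpos: "Q t s > 0" for t s
    using nz[OF Z(1)[of t] Z(1)[of s]] by (simp add: Q_def)
  have contk: "continuous_on (ball 0 1) k"
    by (rule holomorphic_on_imp_continuous_on[OF k])
  have contkZ: "continuous_on A (\<lambda>t. k (Z t))" for A
    by (rule continuous_on_compose2[OF contk contZ]) (use Z in auto)
  have contx: "continuous_on A x" for A
    unfolding x_def cis_conv_exp by (intro continuous_intros contkZ)
  have contD: "continuous_on ?B (\<lambda>p. diff_quot k (Z (fst p)) (Z (snd p)))"
  proof -
    have "continuous_on ?B (\<lambda>p. (Z (fst p), Z (snd p)))"
      by (intro continuous_intros continuous_on_compose2[OF contZ[of UNIV]]) auto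
    from continuous_on_compose2[OF continuous_on_diff_quot[OF k open_ball convex_ball] this]
    show ?thesis using Z by (auto simp: image_subset_iff)
  qed
  have contQ: "continuous_on ?B (\<lambda>p. Q (fst p) (snd p))"
    unfolding Q_def
    by (intro continuous_intros contD continuous_on_compose2[OF contZ[of UNIV]] continuous_on_compose2[OF contkZ[of UNIV]]) auto
  have contd: "continuous_on ?B (\<lambda>p. d (fst p) (snd p))"
    unfolding d_def cis_conv_exp by (intro continuous_intros)
  have Bne: "?B \<noteq> {}" by (auto simp: cbox_Pair_eq)
  obtain m where m: "m > 0" "\<And>p. p \<in> ?B \<Longrightarrow> m \<le> Q (fst p) (snd p)"
    using continuous_attains_inf[OF compact_cbox Bne contQ] Qpos by blast
  obtain M where M: "\<And>p. p \<in> ?B \<Longrightarrow> Q (fst p) (snd p) \<le> M"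
    using continuous_attains_sup[OF compact_cbox Bne contQ] by blast
  have M0: "M > 0"
    using M[of "(0,0)"] Qpos[of 0 0] by (force simp: cbox_Pair_eq)
  define C where "C = 1 / m + M"
  have C0: "C > 0" using m M0 by (simp add: C_def add_pos_pos)
  \<comment> \<open>Multiplication by the unimodular number \<open>cis t * cis s\<close> brings the
    difference into the form of \<open>diff_quot_kernel_mult\<close>.\<close>
  have xd: "(cmod (x t - x s))\<^sup>2 = d t s * Q t s" for t s
  proof -
    have "cis t * cis s * (x t - x s) = (cis t * cis (- t)) * cis s * k (Z t) - (cis s * cis (- s)) * cis t * k (Z s)"
      by (simp only: x_def) (simp only: algebra_simps)
    then have "cis t * cis s * (x t - x s) = cis s * k (Z t) - cis t * k (Z s)"
      by (simp add: cis_mult)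
    also have "of_real r * \<dots> = (Z s - Z t) * (k (Z t) - Z t * diff_quot k (Z t) (Z s))"
      unfolding diff_quot_kernel_mult by (simp add: Z_def algebra_simps)
    also have "\<dots> = of_real r * ((cis s - cis t) * (k (Z t) - Z t * diff_quot k (Z t) (Z s)))"
      by (simp add: Z_def algebra_simps)
    finally have "cis t * cis s * (x t - x s) = (cis s - cis t) * (k (Z t) - Z t * diff_quot k (Z t) (Z s))"
      using r by simp
    then have "cmod (cis t * cis s * (x t - x s)) = cmod (cis s - cis t) * cmod (k (Z t) - Z t * diff_quot k (Z t) (Z s))"
      by (simp add: norm_mult)
    then show ?thesis
      by (simp add: norm_mult power_mult_distrib d_def Q_def norm_minus_commute)
  qed
  have cc: "continuous_on ?B (\<lambda>p. cos (fst p) * cos (snd p))"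
    by (intro continuous_intros)

  have contLQ: "continuous_on ?B (\<lambda>p. cos (fst p) * cos (snd p) * ln (Q (fst p) (snd p)))"
    by (intro continuous_on_mult[OF cc] continuous_on_ln contQ) (use Qpos in \<open>auto simp: less_imp_neq[symmetric] dest: less_imp_neq\<close>)
  \<comment> \<open>The inner integral yields 2 pi r Re F(r e^(it)) with F analytic, so the outer
    one is again a first Taylor coefficient, namely F'(0) = -k''(0)/2.\<close>
  have I1: "integral ?B (\<lambda>p. cos (fst p) * cos (snd p) * ln (Q (fst p) (snd p))) = - (pi\<^sup>2 * r\<^sup>2 * Re (deriv (deriv k) 0))"
  proof -
    define F where "F z = deriv k 0 - diff_quot k 0 z" for z
    have "diff_quot k 0 holomorphic_on ball 0 1"
      by (rule holomorphic_on_diff_quot[OF k open_ball convex_ball]) auto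
    then have F: "F holomorphic_on ball 0 1" and "(diff_quot k 0 has_field_derivative deriv (diff_quot k 0) 0) (at 0)"
      unfolding F_def by (auto intro!: holomorphic_intros holomorphic_derivI)
    then have "(F has_field_derivative - deriv (diff_quot k 0) 0) (at 0)"
      unfolding F_def by (auto intro!: derivative_eq_intros)
    then have dF: "deriv F 0 = - deriv (deriv k) 0 / 2"
      using deriv_diff_quot_diagonal[OF k open_ball convex_ball, of 0] by (simp add: DERIV_imp_deriv)
    have "integral ?B (\<lambda>p. cos (fst p) * cos (snd p) * ln (Q (fst p) (snd p))) =
      integral {0..2*pi} (\<lambda>t. integral {0..2*pi} (\<lambda>s. cos t * (cos s * ln (Q t s))))"
      using integral_prod_continuous[OF contLQ] by (simp add: mult.assoc)
    also have "\<dots> = integral {0..2*pi} (\<lambda>t. 2 * pi * r * (cos t * Re (F (of_real r * cis t))))"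
    proof (intro integral_cong integral_unique)
      fix t
      show "((\<lambda>s. cos t * (cos s * ln (Q t s))) has_integral 2 * pi * r * (cos t * Re (F (of_real r * cis t)))) {0..2*pi}"
        using has_integral_mult_right[OF cos_ln_kernel_integral[OF k k0 nz[OF Z(1)] Z(1) Z(2) r, of t], of "cos t"]
        unfolding Q_def F_def Z_def by (simp add: mult_ac)
    qed
    also have "\<dots> = 2 * pi * r * (pi * r * Re (deriv F 0))"
      by (rule integral_unique[OF has_integral_mult_right[OF Re_circle_cos_integral[OF F r]]])
    finally show ?thesis by (simp add: dF power2_eq_square)
  qed

  have main: "- 2 * pi\<^sup>2 * \<rho> - pi\<^sup>2 * r\<^sup>2 * Re (deriv (deriv k) 0) \<le> C * (4 * pi\<^sup>2 * ((1 - \<rho>) / (1 + \<rho>)))"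
    if \<rho>: "0 < \<rho>" "\<rho> < 1" for \<rho>
  proof -
    \<comment> \<open>For this \<epsilon>, d + \<epsilon> is |1 - w|^2 / \<rho> with |w| = \<rho>, so its logarithm is harmonic up to a constant.\<close>
    define \<epsilon> where "\<epsilon> = (1 - \<rho>)\<^sup>2 / \<rho>"
    have \<epsilon>: "\<epsilon> > 0" using \<rho> by (simp add: \<epsilon>_def)
    have d\<epsilon>: "d t s + \<epsilon> > 0" for t s using \<epsilon> by (simp add: d_def add_nonneg_pos)
    have dQ\<epsilon>: "d t s * Q t s + \<epsilon> > 0" for t s
      using \<epsilon> Qpos[of t s] by (simp add: d_def add_nonneg_pos)
    \<comment> \<open>The energy is regularised as ln (d Q + \<epsilon>), whereas the computable
      integrals are those of ln (d + \<epsilon>) and ln Q; \<open>E\<close> is the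
      discrepancy.\<close>
    define E where "E t s = ln (d t s * Q t s + \<epsilon>) - ln (d t s + \<epsilon>) - ln (Q t s)" for t s
    have contLd: "continuous_on ?B (\<lambda>p. cos (fst p) * cos (snd p) * ln (d (fst p) (snd p) + \<epsilon>))"
      by (intro continuous_on_mult[OF cc] continuous_on_ln continuous_intros contd) (use d\<epsilon> in \<open>metis less_irrefl\<close>)
    have contE: "continuous_on ?B (\<lambda>p. E (fst p) (snd p))"
      unfolding E_def
      by (intro continuous_intros contd contQ) (use d\<epsilon> dQ\<epsilon> Qpos in \<open>metis less_irrefl\<close>)+
    have contK: "continuous_on ?B (\<lambda>p. \<epsilon> * (1 / (d (fst p) (snd p) + \<epsilon>)))"
      by (intro continuous_intros contd) (use d\<epsilon> in \<open>metis less_irrefl\<close>)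
    have I2: "integral ?B (\<lambda>p. cos (fst p) * cos (snd p) * ln (d (fst p) (snd p) + \<epsilon>)) = - 2 * pi\<^sup>2 * \<rho>"
    proof -
      have "integral ?B (\<lambda>p. cos (fst p) * cos (snd p) * ln (d (fst p) (snd p) + \<epsilon>)) =
        integral {0..2*pi} (\<lambda>t. integral {0..2*pi} (\<lambda>s. cos t * (cos s * ln (d t s + \<epsilon>))))"
        using integral_prod_continuous[OF contLd] by (simp add: mult.assoc)
      \<comment> \<open>The inner integral is a multiple of \<rho> cos t, read as the real part of
        the identity function on the circle of radius \<rho>.\<close>
      also have "\<dots> = integral {0..2*pi} (\<lambda>t. - 2 * pi * (cos t * Re (of_real \<rho> * cis t)))"
      proof (intro integral_cong integral_unique)
        fix t
        show "((\<lambda>s. cos t * (cos s * ln (d t s + \<epsilon>))) has_integral - 2 * pi * (cos t * Re (of_real \<rho> * cis t))) {0..2*pi}"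
          using has_integral_mult_right[OF cos_ln_chord_integral[OF \<rho>, of t], of "cos t"]
          unfolding d_def \<epsilon>_def by (simp add: mult_ac)
      qed
      also have "\<dots> = - 2 * pi * (pi * \<rho> * Re (deriv (\<lambda>z. z) 0))"
        by (rule integral_unique[OF has_integral_mult_right[OF Re_circle_cos_integral[OF holomorphic_on_ident \<rho>]]])
      finally show ?thesis by (simp add: power2_eq_square)
    qed
    have I3: "integral ?B (\<lambda>p. \<epsilon> * (1 / (d (fst p) (snd p) + \<epsilon>))) = 4 * pi\<^sup>2 * ((1 - \<rho>) / (1 + \<rho>))"
    proof -
      have "integral ?B (\<lambda>p. \<epsilon> * (1 / (d (fst p) (snd p) + \<epsilon>))) =
        integral {0..2*pi} (\<lambda>t. integral {0..2*pi} (\<lambda>s. \<epsilon> * (1 / (d t s + \<epsilon>))))"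
        using integral_prod_continuous[OF contK] by simp
      also have "\<dots> = integral {0..2*pi} (\<lambda>t. \<epsilon> * (2 * pi * \<rho> / (1 - \<rho>\<^sup>2)))"
        unfolding d_def \<epsilon>_def
        by (intro integral_cong integral_unique has_integral_mult_right poisson_chord_integral \<rho>)
      also have "\<dots> = 2 * pi * (\<epsilon> * (2 * pi * \<rho> / (1 - \<rho>\<^sup>2)))" by simp
      also have "1 - \<rho>\<^sup>2 = (1 - \<rho>) * (1 + \<rho>)" by (simp add: power2_eq_square algebra_simps)
      finally show ?thesis
        using \<rho> by (simp add: \<epsilon>_def power2_eq_square)
    qed
    have Ebound: "\<bar>E (fst p) (snd p)\<bar> \<le> C * (\<epsilon> * (1 / (d (fst p) (snd p) + \<epsilon>)))" if "p \<in> ?B" for p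
      unfolding E_def C_def using that m M \<epsilon> by (intro ln_regularization_error) (auto simp: d_def)
    have I4: "- (C * (4 * pi\<^sup>2 * ((1 - \<rho>) / (1 + \<rho>)))) \<le> integral ?B (\<lambda>p. cos (fst p) * cos (snd p) * E (fst p) (snd p))"
    proof -
      have "norm (integral ?B (\<lambda>p. cos (fst p) * cos (snd p) * E (fst p) (snd p))) \<le>
          integral ?B (\<lambda>p. C * (\<epsilon> * (1 / (d (fst p) (snd p) + \<epsilon>))))"
      proof (rule integral_norm_bound_integral)
        show "(\<lambda>p. cos (fst p) * cos (snd p) * E (fst p) (snd p)) integrable_on ?B"
          by (intro integrable_continuous continuous_on_mult[OF cc contE])
        show "(\<lambda>p. C * (\<epsilon> * (1 / (d (fst p) (snd p) + \<epsilon>)))) integrable_on ?B"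
          by (intro integrable_continuous continuous_on_mult[OF continuous_on_const contK])
        fix p assume p: "p \<in> ?B"
        have "\<bar>cos (fst p) * cos (snd p)\<bar> \<le> 1"
          unfolding abs_mult by (intro mult_le_one) auto
        then have "\<bar>cos (fst p) * cos (snd p)\<bar> * \<bar>E (fst p) (snd p)\<bar> \<le> 1 * \<bar>E (fst p) (snd p)\<bar>"
          by (intro mult_right_mono) auto
        with Ebound[OF p] show "norm (cos (fst p) * cos (snd p) * E (fst p) (snd p)) \<le> C * (\<epsilon> * (1 / (d (fst p) (snd p) + \<epsilon>)))"
          by (simp add: abs_mult)
      qed
      also have "\<dots> = C * (4 * pi\<^sup>2 * ((1 - \<rho>) / (1 + \<rho>)))"
        unfolding I3[symmetric] by (rule integral_mult_right)
      finally show ?thesis by simp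
    qed
    have "integral {0..2*pi} cos = 0"
      using Re_circle_cos_integral[OF holomorphic_on_const \<rho>, of 1] by (auto intro: integral_unique)
    then have "integral ?B (\<lambda>(t, s). cos t * cos s * ln ((cmod (x t - x s))\<^sup>2 + \<epsilon>)) \<le> 0"
      by (intro log_energy_nonpos contx \<epsilon> continuous_on_cos continuous_on_id)
    also have "(\<lambda>(t, s). cos t * cos s * ln ((cmod (x t - x s))\<^sup>2 + \<epsilon>)) =
       (\<lambda>p. cos (fst p) * cos (snd p) * ln (d (fst p) (snd p) + \<epsilon>) +
            cos (fst p) * cos (snd p) * ln (Q (fst p) (snd p)) +
            cos (fst p) * cos (snd p) * E (fst p) (snd p))"
      by (rule ext) (simp add: case_prod_unfold xd E_def algebra_simps)
    also have "integral ?B \<dots> = - 2 * pi\<^sup>2 * \<rho> + - (pi\<^sup>2 * r\<^sup>2 * Re (deriv (deriv k) 0)) +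
        integral ?B (\<lambda>p. cos (fst p) * cos (snd p) * E (fst p) (snd p))"
      unfolding I1[symmetric] I2[symmetric]
      by (subst integral_add, (intro integrable_add integrable_continuous contLd contLQ continuous_on_mult[OF cc contE])+)
         (subst integral_add, (intro integrable_add integrable_continuous contLd contLQ)+, simp)
    finally show ?thesis using I4 by simp
  qed
  \<comment> \<open>The constant \<open>C\<close> comes from the bounds \<open>m\<close> and
    \<open>M\<close> on \<open>Q\<close> and does not depend on \<rho>, so the error vanishes in the
    limit.\<close>
  have "((\<lambda>\<rho>. - 2 * pi\<^sup>2 * \<rho> - pi\<^sup>2 * r\<^sup>2 * Re (deriv (deriv k) 0)) \<longlongrightarrow>
      - 2 * pi\<^sup>2 * 1 - pi\<^sup>2 * r\<^sup>2 * Re (deriv (deriv k) 0)) (at_left (1::real))"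
    by (intro tendsto_intros)
  moreover have "((\<lambda>\<rho>. C * (4 * pi\<^sup>2 * ((1 - \<rho>) / (1 + \<rho>)))) \<longlongrightarrow> C * (4 * pi\<^sup>2 * ((1 - 1) / (1 + 1)))) (at_left (1::real))"
    by (intro tendsto_intros) auto
  moreover have "eventually (\<lambda>\<rho>. 0 < \<rho> \<and> \<rho> < 1) (at_left (1::real))"
    using eventually_at_left_real[of 0 1] by (auto elim: eventually_mono)
  then have "eventually (\<lambda>\<rho>. - 2 * pi\<^sup>2 * \<rho> - pi\<^sup>2 * r\<^sup>2 * Re (deriv (deriv k) 0) \<le>
      C * (4 * pi\<^sup>2 * ((1 - \<rho>) / (1 + \<rho>)))) (at_left (1::real))"
    by (rule eventually_mono) (use main in auto)
  ultimately have "- 2 * pi\<^sup>2 * 1 - pi\<^sup>2 * r\<^sup>2 * Re (deriv (deriv k) 0) \<le> C * (4 * pi\<^sup>2 * ((1 - 1) / (1 + 1)))"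
    by (intro tendsto_le[OF trivial_limit_at_left_real])
  then have "pi\<^sup>2 * (- 2) \<le> pi\<^sup>2 * (r\<^sup>2 * Re (deriv (deriv k) 0))"
    by (simp add: algebra_simps)
  then show ?thesis
    by (subst (asm) mult_le_cancel_left_pos) auto
qed

lemma Re_deriv2_ge_if_kernel_nonzero:
  assumes "k holomorphic_on ball 0 1" "k 0 = 1"
    and "\<And>z w. z \<in> ball 0 1 \<Longrightarrow> w \<in> ball 0 1 \<Longrightarrow> k z - z * diff_quot k z w \<noteq> 0"
  shows "- 2 \<le> Re (deriv (deriv k) 0)"
proof -
  have "((\<lambda>r. r\<^sup>2 * Re (deriv (deriv k) 0)) \<longlongrightarrow> 1\<^sup>2 * Re (deriv (deriv k) 0)) (at_left (1::real))"
    by (intro tendsto_intros)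
  moreover have "eventually (\<lambda>r. - 2 \<le> r\<^sup>2 * Re (deriv (deriv k) 0)) (at_left (1::real))"
    by (rule eventually_mono[OF eventually_at_left_real[of 0]]) (use radius_sq_Re_deriv2_ge_if_kernel_nonzero[OF assms] in auto)
  ultimately show ?thesis
    using tendsto_lowerbound[OF _ _ trivial_limit_at_left_real] by fastforce
qed

section \<open>Bieberbach's bound for the second coefficient\<close>

text \<open>With g(z) = f(z)/z and k(z) = g(z^2)^(-1/2), the function k(z)/z is the reciprocal of
  the odd square root transform of f and inherits its injectivity. Since k''(0) = -f''(0)/2, the
  bound Re k''(0) \<ge> -2 is the claim.\<close>

lemma Re_deriv2_le_normalized:
  assumes f: "f holomorphic_on ball 0 1" and inj: "inj_on f (ball 0 1)"
    and f0: "f 0 = 0" and f1: "deriv f 0 = 1"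
  shows "Re (deriv (deriv f) 0) \<le> 4"
proof -
  define g where "g = diff_quot f 0"
  have g: "g holomorphic_on ball 0 1"
    unfolding g_def by (rule holomorphic_on_diff_quot[OF f open_ball convex_ball]) auto
  have fg: "f z = z * g z" for z
    using diff_quot_mult[of 0 z f] by (simp add: g_def f0)
  have g0: "g 0 = 1" by (simp add: g_def diff_quot_def f1)
  have gnz: "g z \<noteq> 0" if "z \<in> ball 0 1" for z
  proof (cases "z = 0")
    case False
    then have "f z \<noteq> f 0" using inj that by (auto dest: inj_onD)
    then show ?thesis by (auto simp: fg[of z] f0)
  qed (simp add: g0)
  obtain L where L: "L holomorphic_on ball 0 1" "\<And>z. z \<in> ball 0 1 \<Longrightarrow> exp (L z) = g z"
    using holomorphic_logarithm_exists[OF convex_ball open_ball g gnz, of 0] by auto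
  have dL: "(L has_field_derivative deriv L z) (at z)" "(deriv L has_field_derivative deriv (deriv L) z) (at z)"
    if "z \<in> ball 0 1" for z
    using L(1) that by (auto intro!: holomorphic_derivI holomorphic_deriv)
  have dg: "(g has_field_derivative g z * deriv L z) (at z)" if z: "z \<in> ball 0 1" for z
  proof -
    have "((\<lambda>z. exp (L z)) has_field_derivative exp (L z) * deriv L z) (at z)"
      by (auto intro!: derivative_eq_intros dL z)
    then have "((\<lambda>z. exp (L z)) has_field_derivative g z * deriv L z) (at z)"
      by (simp add: L(2)[OF z])
    then show ?thesis
      by (rule has_field_derivative_transform_within_open[of _ _ _ "ball 0 1"]) (use L z in auto)
  qed
  have dL0: "deriv L 0 = deriv (deriv f) 0 / 2"
    using deriv_diff_quot_diagonal[OF f open_ball convex_ball, of 0] DERIV_imp_deriv[OF dg[of 0]]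
    by (simp add: g0 flip: g_def)
  have df: "deriv f z = g z * (1 + z * deriv L z)" if "z \<in> ball 0 1" for z
  proof (rule DERIV_imp_deriv)
    have "((\<lambda>z. z * g z) has_field_derivative g z * (1 + z * deriv L z)) (at z)"
      by (auto intro!: derivative_eq_intros dg that simp: algebra_simps)
    then show "(f has_field_derivative g z * (1 + z * deriv L z)) (at z)"
      by (simp only: fg[symmetric])
  qed
  \<comment> \<open>Subtracting \<open>L 0\<close>, which may be a nonzero multiple of 2 pi i,
    selects the branch of the square root with k(0) = 1.\<close>
  define k where "k z = exp (- (L (z\<^sup>2) - L 0) / 2)" for z
  have sq: "z\<^sup>2 \<in> ball 0 1" if "z \<in> ball 0 1" for z :: complex
    using that by (simp add: norm_power power_less_one_iff)
  have k: "k holomorphic_on ball 0 1"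
    unfolding k_def
    by (intro holomorphic_intros holomorphic_on_compose_gen[OF _ L(1), unfolded o_def]) (use sq in auto)
  have k0: "k 0 = 1" by (simp add: k_def)
  have knz: "k z \<noteq> 0" for z by (simp add: k_def)
  have k2: "(k z)\<^sup>2 * g (z\<^sup>2) = 1" if "z \<in> ball 0 1" for z
  proof -
    have "(k z)\<^sup>2 = exp (L 0 - L (z\<^sup>2))"
      unfolding k_def exp_double[symmetric] by (simp add: diff_divide_distrib)
    then show ?thesis
      using L(2)[OF sq[OF that]] L(2)[of 0] gnz[OF sq[OF that]] by (simp add: exp_diff g0)
  qed
  have dk: "(k has_field_derivative - z * deriv L (z\<^sup>2) * k z) (at z)" if "z \<in> ball 0 1" for z
  proof -
    have "((\<lambda>z. L (z\<^sup>2)) has_field_derivative deriv L (z\<^sup>2) * (2 * z)) (at z)"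
      by (rule DERIV_chain2[where f = L and g = "\<lambda>z. z\<^sup>2", OF dL(1)[OF sq[OF that]]])
         (auto intro!: derivative_eq_intros)
    then show ?thesis
      unfolding k_def by (auto intro!: derivative_eq_intros)
  qed
  then have deriv_k: "deriv k z = - z * deriv L (z\<^sup>2) * k z" if "z \<in> ball 0 1" for z
    using that by (intro DERIV_imp_deriv)
  have "((\<lambda>z. deriv L (z\<^sup>2)) has_field_derivative deriv (deriv L) (0\<^sup>2) * 0) (at 0)"
    by (rule DERIV_chain2[where f = "deriv L" and g = "\<lambda>z. z\<^sup>2", OF dL(2)])
       (auto intro!: derivative_eq_intros)
  then have "((\<lambda>z. - z * deriv L (z\<^sup>2) * k z) has_field_derivative - deriv L 0) (at 0)"
    by (auto intro!: derivative_eq_intros dk simp: k0)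
  then have "(deriv k has_field_derivative - deriv L 0) (at 0)"
    by (rule has_field_derivative_transform_within_open[of _ _ _ "ball 0 1"]) (use deriv_k in auto)
  then have ddk: "deriv (deriv k) 0 = - deriv (deriv f) 0 / 2"
    by (simp add: DERIV_imp_deriv dL0)
  have nz: "k z - z * diff_quot k z w \<noteq> 0" if z: "z \<in> ball 0 1" and w: "w \<in> ball 0 1" for z w
  proof (cases "z = w")
    case True
    \<comment> \<open>On the diagonal the kernel is k(z) (1 + z^2 L'(z^2)), and the bracket is
      f'(z^2) / g(z^2).\<close>
    have "deriv f (z\<^sup>2) \<noteq> 0"
      by (rule holomorphic_injective_imp_regular[OF f open_ball inj sq[OF z]])
    then have "1 + z\<^sup>2 * deriv L (z\<^sup>2) \<noteq> 0"
      by (auto simp: df[OF sq[OF z]])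
    moreover have "k z - z * diff_quot k z w = k z * (1 + z\<^sup>2 * deriv L (z\<^sup>2))"
      unfolding True[symmetric] diff_quot_def by (simp add: deriv_k[OF z] algebra_simps power2_eq_square)
    ultimately show ?thesis using knz by simp
  next
    case False
    show ?thesis
    proof
      assume "k z - z * diff_quot k z w = 0"
      then have eq: "w * k z = z * k w"
        using diff_quot_kernel_mult[of w z k] by simp
      then have z0: "z \<noteq> 0" and w0: "w \<noteq> 0"
        using False knz by auto
      \<comment> \<open>A zero off the diagonal would give f(z^2) = f(w^2), hence w = -z. But k is
        even, so k(z)/z is odd and takes distinct values at z and -z.\<close>
      have "w\<^sup>2 * (k z)\<^sup>2 = z\<^sup>2 * (k w)\<^sup>2"
        using eq by (simp flip: power_mult_distrib)
      then have "w\<^sup>2 * ((k z)\<^sup>2 * g (z\<^sup>2)) * g (w\<^sup>2) = z\<^sup>2 * ((k w)\<^sup>2 * g (w\<^sup>2)) * g (z\<^sup>2)"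
        by (simp add: algebra_simps)
      then have "f (w\<^sup>2) = f (z\<^sup>2)"
        by (simp only: k2[OF z] k2[OF w] mult_1_right fg[symmetric])
      then have "w\<^sup>2 = z\<^sup>2"
        using inj sq z w by (auto dest: inj_onD)
      then have "w = - z"
        using False by (auto simp: power2_eq_iff)
      then have "k w = k z" by (simp add: k_def)
      with eq \<open>w = - z\<close> z0 knz[of z] show False by simp
    qed
  qed
  have "- 2 \<le> Re (deriv (deriv k) 0)"
    by (rule Re_deriv2_ge_if_kernel_nonzero[OF k k0 nz])
  then show ?thesis by (simp add: ddk)
qed

text \<open>A rotation of the disk makes f''(0)/f'(0) real and nonnegative, so the bound on the real
  part becomes a bound on the modulus.\<close>

lemma deriv2_at_zero_le_if_inj:
  assumes f: "f holomorphic_on ball 0 1" and inj: "inj_on f (ball 0 1)"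
  shows "cmod (deriv (deriv f) 0) \<le> 4 * cmod (deriv f 0)"
proof -
  define a where "a = deriv f 0"
  have a: "a \<noteq> 0"
    unfolding a_def by (rule holomorphic_injective_imp_regular[OF f open_ball inj]) auto
  define b where "b = deriv (deriv f) 0 / a"
  \<comment> \<open>The case b = 0 is separate because \<open>sgn 0\<close> is 0, which is not
    unimodular.\<close>
  define u where "u = (if b = 0 then 1 else cnj (sgn b))"
  have u: "cmod u = 1" "u \<noteq> 0" by (auto simp: u_def norm_sgn sgn_zero_iff)
  have ub: "u * b = of_real (cmod b)"
    by (simp add: u_def sgn_div_norm scaleR_conv_of_real complex_norm_square[symmetric] power2_eq_square
        mult.commute[of _ b] flip: mult.assoc)
  have ball: "u * z \<in> ball 0 1" if "z \<in> ball 0 1" for z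
    using that u by (simp add: norm_mult)
  define F where "F z = (f (u * z) - f 0) / (a * u)" for z
  have F: "F holomorphic_on ball 0 1"
    unfolding F_def
    by (intro holomorphic_intros holomorphic_on_compose_gen[OF _ f, unfolded o_def]) (use ball a u in auto)
  have injF: "inj_on F (ball 0 1)"
  proof (rule inj_onI)
    fix z w assume "z \<in> ball 0 1" "w \<in> ball 0 1" "F z = F w"
    then have "f (u * z) = f (u * w)" using a u by (simp add: F_def)
    then have "u * z = u * w" using inj ball \<open>z \<in> ball 0 1\<close> \<open>w \<in> ball 0 1\<close> by (blast dest: inj_onD)
    then show "z = w" using u by simp
  qed
  have df: "(f has_field_derivative deriv f z) (at z)" "(deriv f has_field_derivative deriv (deriv f) z) (at z)"
    if "z \<in> ball 0 1" for z
    using f that by (auto intro!: holomorphic_derivI holomorphic_deriv)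
  have dF: "deriv F z = deriv f (u * z) / a" if "z \<in> ball 0 1" for z
  proof (rule DERIV_imp_deriv)
    have "((\<lambda>z. f (u * z)) has_field_derivative deriv f (u * z) * u) (at z)"
      by (rule DERIV_chain2[where f = f and g = "\<lambda>z. u * z", OF df(1)[OF ball[OF that]]])
         (auto intro!: derivative_eq_intros)
    then show "(F has_field_derivative deriv f (u * z) / a) (at z)"
      unfolding F_def using a u by (auto intro!: derivative_eq_intros)
  qed
  have "((\<lambda>z. deriv f (u * z)) has_field_derivative deriv (deriv f) (u * 0) * u) (at 0)"
    by (rule DERIV_chain2[where f = "deriv f" and g = "\<lambda>z. u * z", OF df(2)])
       (auto intro!: derivative_eq_intros)
  then have "((\<lambda>z. deriv f (u * z) / a) has_field_derivative u * b) (at 0)"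
    unfolding b_def using a by (auto intro!: derivative_eq_intros)
  then have "(deriv F has_field_derivative u * b) (at 0)"
    by (rule has_field_derivative_transform_within_open[of _ _ _ "ball 0 1"]) (use dF in auto)
  then have "deriv (deriv F) 0 = of_real (cmod b)"
    unfolding ub by (rule DERIV_imp_deriv)
  moreover have "Re (deriv (deriv F) 0) \<le> 4"
    by (rule Re_deriv2_le_normalized[OF F injF]) (use a dF[of 0] in \<open>auto simp: F_def a_def\<close>)
  ultimately show ?thesis
    using a by (simp add: b_def norm_divide divide_le_eq flip: a_def)
qed

section \<open>The second coefficient of a convex function\<close>

text \<open>Convexity keeps the midpoint m(z) of f(z) and f(-z) in the image, so \<phi>, the inverse
  of f applied to m, is a self-map of the disk. Differentiating f(\<phi>(z)) = m(z) twice at 0 gives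
  \<phi>'(0) = 0 and then f'(0) \<phi>''(0) = f''(0).\<close>

lemma deriv2_at_zero_le_if_convex_image:
  assumes f: "f holomorphic_on ball 0 1" and inj: "inj_on f (ball 0 1)" and conv: "convex (f ` ball 0 1)"
  shows "cmod (deriv (deriv f) 0) \<le> 2 * cmod (deriv f 0)"
proof -
  define a where "a = deriv f 0"
  have a: "a \<noteq> 0"
    unfolding a_def by (rule holomorphic_injective_imp_regular[OF f open_ball inj]) auto
  obtain g where g: "g holomorphic_on f ` ball 0 1" "\<And>z. z \<in> ball 0 1 \<Longrightarrow> g (f z) = z"
    using holomorphic_has_inverse[OF f open_ball inj] by metis
  define m where "m z = (f z + f (- z)) / 2" for z
  define \<phi> where "\<phi> z = g (m z)" for z
  have m_in: "m z \<in> f ` ball 0 1" if "z \<in> ball 0 1" for z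
  proof -
    have "(1/2) *\<^sub>R f z + (1/2) *\<^sub>R f (- z) \<in> f ` ball 0 1"
      using that by (intro convexD[OF conv]) auto
    then show ?thesis by (simp add: m_def scaleR_conv_of_real add_divide_distrib)
  qed
  have m: "m holomorphic_on ball 0 1"
    unfolding m_def
    by (intro holomorphic_intros f holomorphic_on_compose_gen[OF _ f, unfolded o_def]) auto
  have \<phi>: "\<phi> holomorphic_on ball 0 1"
    unfolding \<phi>_def using holomorphic_on_compose_gen[OF m g(1)] m_in by (auto simp: o_def image_subset_iff)
  have \<phi>_ball: "\<phi> z \<in> ball 0 1" and f\<phi>: "f (\<phi> z) = m z" if "z \<in> ball 0 1" for z
    using m_in[OF that] g(2) by (auto simp: \<phi>_def)
  have \<phi>0: "\<phi> 0 = 0"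
    using g(2)[of 0] by (simp add: \<phi>_def m_def)
  have df: "(f has_field_derivative deriv f z) (at z)" "(deriv f has_field_derivative deriv (deriv f) z) (at z)"
    if "z \<in> ball 0 1" for z
    using f that by (auto intro!: holomorphic_derivI holomorphic_deriv)
  have d\<phi>: "(\<phi> has_field_derivative deriv \<phi> z) (at z)" "(deriv \<phi> has_field_derivative deriv (deriv \<phi>) z) (at z)"
    if "z \<in> ball 0 1" for z
    using \<phi> that by (auto intro!: holomorphic_derivI holomorphic_deriv)
  have eq1: "deriv f (\<phi> z) * deriv \<phi> z = (deriv f z - deriv f (- z)) / 2" if z: "z \<in> ball 0 1" for z
  proof (rule DERIV_unique)
    have "((\<lambda>z. f (\<phi> z)) has_field_derivative deriv f (\<phi> z) * deriv \<phi> z) (at z)"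
      by (rule DERIV_chain2[OF df(1)[OF \<phi>_ball[OF z]] d\<phi>(1)[OF z]])
    then show "(m has_field_derivative deriv f (\<phi> z) * deriv \<phi> z) (at z)"
      by (rule has_field_derivative_transform_within_open[of _ _ _ "ball 0 1"]) (use f\<phi> z in auto)
    show "(m has_field_derivative (deriv f z - deriv f (- z)) / 2) (at z)"
    proof -
      have "((\<lambda>z. f (- z)) has_field_derivative deriv f (- z) * (- 1)) (at z)"
        by (rule DERIV_chain2[where f = f and g = uminus, OF df(1)])
           (use z in \<open>auto intro!: derivative_eq_intros\<close>)
      then show ?thesis
        unfolding m_def by (auto intro!: derivative_eq_intros df(1)[OF z])
    qed
  qed
  from eq1[of 0] have \<phi>1: "deriv \<phi> 0 = 0"
    using a by (simp add: \<phi>0 a_def)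
  have "a * deriv (deriv \<phi>) 0 = deriv (deriv f) 0"
  proof (rule DERIV_unique)
    let ?M = "\<lambda>z. (deriv f z - deriv f (- z)) / 2"
    have "((\<lambda>z. deriv f (\<phi> z)) has_field_derivative deriv (deriv f) (\<phi> 0) * deriv \<phi> 0) (at 0)"
      by (rule DERIV_chain2[where f = "deriv f" and g = \<phi>, OF df(2) d\<phi>(1)]) (auto simp: \<phi>0)
    then have "((\<lambda>z. deriv f (\<phi> z) * deriv \<phi> z) has_field_derivative a * deriv (deriv \<phi>) 0) (at 0)"
      by (auto intro!: derivative_eq_intros d\<phi> simp: \<phi>0 \<phi>1 a_def)
    then show "(?M has_field_derivative a * deriv (deriv \<phi>) 0) (at 0)"
      by (rule has_field_derivative_transform_within_open[of _ _ _ "ball 0 1"]) (use eq1 in auto)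
    show "(?M has_field_derivative deriv (deriv f) 0) (at 0)"
    proof -
      have "((\<lambda>z. deriv f (- z)) has_field_derivative deriv (deriv f) (- 0) * (- 1)) (at 0)"
        by (rule DERIV_chain2[where f = "deriv f" and g = uminus, OF df(2)])
           (auto intro!: derivative_eq_intros)
      then show ?thesis
        by (auto intro!: derivative_eq_intros df(2))
    qed
  qed
  then have ratio: "cmod (deriv (deriv f) 0) = cmod a * cmod (deriv (deriv \<phi>) 0)"
    by (metis norm_mult)
  \<comment> \<open>Cauchy's inequality on |z| = r with |\<phi>| \<le> 1; the constant 2 is the
    factorial, and r tends to 1 afterwards.\<close>
  have le: "r\<^sup>2 * cmod (deriv (deriv \<phi>) 0) \<le> 2" if r: "0 < r" "r < 1" for r
  proof -
    have "cmod ((deriv ^^ 2) \<phi> 0) \<le> fact 2 * 1 / r ^ 2"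
    proof (rule Cauchy_inequality)
      show "\<phi> holomorphic_on ball 0 r" "continuous_on (cball 0 r) \<phi>"
        using \<phi> r by (auto intro!: holomorphic_on_imp_continuous_on intro: holomorphic_on_subset)
      show "cmod (\<phi> x) \<le> 1" if "cmod (0 - x) = r" for x
        using \<phi>_ball[of x] that r by (simp add: less_imp_le)
    qed (use r in auto)
    then show ?thesis
      using r by (simp add: numeral_2_eq_2 field_simps)
  qed
  have "((\<lambda>r. r\<^sup>2 * cmod (deriv (deriv \<phi>) 0)) \<longlongrightarrow> 1\<^sup>2 * cmod (deriv (deriv \<phi>) 0)) (at_left (1::real))"
    by (intro tendsto_intros)
  moreover have "eventually (\<lambda>r. r\<^sup>2 * cmod (deriv (deriv \<phi>) 0) \<le> 2) (at_left (1::real))"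
    by (rule eventually_mono[OF eventually_at_left_real[of 0]]) (use le in auto)
  ultimately have "cmod (deriv (deriv \<phi>) 0) \<le> 2"
    using tendsto_upperbound[OF _ _ trivial_limit_at_left_real] by fastforce
  then show ?thesis
    unfolding ratio a_def[symmetric] by (simp add: mult.commute mult_left_mono)
qed

section \<open>The Jacobian\<close>

lemma mult_cnj_eq_cmod_sq: "z * cnj z = (complex_of_real (cmod z))\<^sup>2"
  by (metis complex_norm_square of_real_power)

lemma Moebius_image_ball:
  assumes "cmod w < 1"
  shows "Moebius_function 0 w ` ball 0 1 = ball 0 1" "inj_on (Moebius_function 0 w) (ball 0 1)"
proof -
  have inv: "Moebius_function 0 (- w) (Moebius_function 0 w z) = z"
    "Moebius_function 0 w (Moebius_function 0 (- w) z) = z" if "z \<in> ball 0 1" for z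
    using that assms by (auto intro!: Moebius_function_compose)
  have mem: "Moebius_function 0 v z \<in> ball 0 1" if "cmod v < 1" "z \<in> ball 0 1" for v z
    using that by (simp add: Moebius_function_norm_lt_1)
  show "inj_on (Moebius_function 0 w) (ball 0 1)"
    using inv(1) by (rule inj_on_inverseI)
  have "z \<in> Moebius_function 0 w ` ball 0 1" if "z \<in> ball 0 1" for z
    using inv(2)[OF that] mem[of "- w" z] assms that by (metis image_eqI norm_minus_cancel)
  then show "Moebius_function 0 w ` ball 0 1 = ball 0 1"
    using mem[OF assms] by auto
qed

text \<open>The automorphism m(w) = (w + z) / (1 + cnj z w) sends 0 to z. With q = 1 - |z|^2 the
  composite F of h with m has F'(0) = q h'(z) and F''(0) = q (q h''(z) - 2 cnj z h'(z)); the common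
  factor q cancels.\<close>

lemma deriv2_bound_transport:
  assumes h: "h holomorphic_on ball 0 1" and z: "z \<in> ball 0 1"
    and bound: "cmod (deriv (deriv (h \<circ> Moebius_function 0 (- z))) 0) \<le> C * cmod (deriv (h \<circ> Moebius_function 0 (- z)) 0)"
  shows "cmod (of_real (1 - (cmod z)\<^sup>2) * deriv (deriv h) z - 2 * cnj z * deriv h z) \<le> C * cmod (deriv h z)"
proof -
  define F where "F = h \<circ> Moebius_function 0 (- z)"
  define m where "m = Moebius_function 0 (- z)"
  define q where "q = 1 - (cmod z)\<^sup>2"
  define m' where "m' w = of_real q / (1 + cnj z * w)\<^sup>2" for w
  have q: "q > 0" using z by (simp add: q_def power_less_one_iff)
  have q_eq: "of_real q = 1 - z * cnj z"
    by (simp add: q_def mult_cnj_eq_cmod_sq)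
  have nz: "1 + cnj z * w \<noteq> 0" if "w \<in> ball 0 1" for w
  proof
    assume "1 + cnj z * w = 0"
    then have "cmod (cnj z * w) = cmod (- 1)" by (metis add.commute add_eq_0_iff)
    then show False using z that mult_strict_mono[of "cmod z" 1 "cmod w" 1] by (simp add: norm_mult)
  qed
  have m_eq: "m w = (w + z) / (1 + cnj z * w)" for w
    by (simp add: m_def Moebius_function_simple)
  have m_ball: "m w \<in> ball 0 1" if "w \<in> ball 0 1" for w
    using that z by (simp add: m_def Moebius_function_norm_lt_1)
  have dm: "(m has_field_derivative m' w) (at w)" if "w \<in> ball 0 1" for w
    unfolding m_eq[abs_def] m'_def using nz[OF that]
    by (auto intro!: derivative_eq_intros simp: q_eq power2_eq_square algebra_simps)
  have dm': "(m' has_field_derivative - 2 * cnj z * of_real q) (at 0)"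
    unfolding m'_def by (auto intro!: derivative_eq_intros simp: power2_eq_square)
  have dh: "(h has_field_derivative deriv h w) (at w)" "(deriv h has_field_derivative deriv (deriv h) w) (at w)"
    if "w \<in> ball 0 1" for w
    using h that by (auto intro!: holomorphic_derivI holomorphic_deriv)
  have dF: "deriv F w = deriv h (m w) * m' w" if "w \<in> ball 0 1" for w
    unfolding F_def m_def[symmetric] o_def
    by (rule DERIV_imp_deriv[OF DERIV_chain2[OF dh(1)[OF m_ball[OF that]] dm[OF that]]])
  have m0: "m 0 = z" "m' 0 = of_real q" by (simp_all add: m_eq m'_def)
  have "((\<lambda>w. deriv h (m w)) has_field_derivative deriv (deriv h) (m 0) * m' 0) (at 0)"
    by (rule DERIV_chain2[where f = "deriv h" and g = m, OF dh(2) dm]) (use z m0 in auto)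
  then have "((\<lambda>w. deriv h (m w) * m' w) has_field_derivative
      of_real q * (of_real q * deriv (deriv h) z - 2 * cnj z * deriv h z)) (at 0)"
    by (auto intro!: derivative_eq_intros dm' simp: m0 algebra_simps)
  then have "(deriv F has_field_derivative
      of_real q * (of_real q * deriv (deriv h) z - 2 * cnj z * deriv h z)) (at 0)"
    by (rule has_field_derivative_transform_within_open[of _ _ _ "ball 0 1"]) (use dF in auto)
  then have "deriv (deriv F) 0 = of_real q * (of_real q * deriv (deriv h) z - 2 * cnj z * deriv h z)"
    by (rule DERIV_imp_deriv)
  moreover have "deriv F 0 = of_real q * deriv h z"
    using dF[of 0] by (simp add: m0)
  ultimately have "q * cmod (of_real q * deriv (deriv h) z - 2 * cnj z * deriv h z) \<le> q * (C * cmod (deriv h z))"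
    using bound q unfolding F_def[symmetric] by (simp add: norm_mult mult_ac)
  then show ?thesis
    using q by (simp add: q_def[symmetric])
qed

text \<open>Multiplying the bound by z / h'(z) confines (1 - r^2) z h''/h' to the disk of radius C r
  about 2 r^2, where r = |z|. Its real part is thus at least 2 r^2 - C r, and adding 1 - r^2 gives
  the claim.\<close>

lemma Re_pre_schwarzian_lower_bound:
  assumes nz: "deriv h z \<noteq> 0"
    and bound: "cmod (of_real (1 - (cmod z)\<^sup>2) * deriv (deriv h) z - 2 * cnj z * deriv h z) \<le> C * cmod (deriv h z)"
  shows "1 + (cmod z)\<^sup>2 - C * cmod z \<le> (1 - (cmod z)\<^sup>2) * Re (1 + z * deriv (deriv h) z / deriv h z)"
proof -
  let ?r = "cmod z" and ?S = "z * deriv (deriv h) z / deriv h z"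
  have "of_real (1 - ?r\<^sup>2) * ?S - 2 * of_real (?r\<^sup>2) =
      z * (of_real (1 - ?r\<^sup>2) * deriv (deriv h) z - 2 * cnj z * deriv h z) / deriv h z"
    using nz unfolding of_real_diff of_real_power of_real_1 mult_cnj_eq_cmod_sq[symmetric]
    by (simp add: field_simps)
  also have "cmod \<dots> \<le> C * ?r"
    using mult_left_mono[OF bound, of ?r] nz by (simp add: norm_mult norm_divide divide_le_eq mult_ac)
  finally have "cmod (of_real (1 - ?r\<^sup>2) * ?S - 2 * of_real (?r\<^sup>2)) \<le> C * ?r" .
  then have "- (C * ?r) \<le> Re (of_real (1 - ?r\<^sup>2) * ?S - 2 * of_real (?r\<^sup>2))"
    using abs_Re_le_cmod[of "of_real (1 - ?r\<^sup>2) * ?S - 2 * of_real (?r\<^sup>2)"] by linarith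
  also have "\<dots> = (1 - ?r\<^sup>2) * Re ?S - 2 * ?r\<^sup>2"
    by (simp only: minus_complex.sel times_complex.sel Re_complex_of_real Im_complex_of_real) simp
  finally show ?thesis by (simp add: distrib_left)
qed

section \<open>Wirtinger derivatives and Jacobian of u\<close>

text \<open>Writing |z|^2 as z times its conjugate lets the product rule produce the derivative as a
  combination of v and \<open>cnj v\<close>, whose coefficients are the two Wirtinger
  derivatives.\<close>

lemma u_of_has_derivative:
  assumes h: "h holomorphic_on ball 0 1" and z: "z \<in> ball 0 1"
  defines "A \<equiv> deriv h z + ((1 - z * cnj z) * (deriv h z + z * deriv (deriv h) z) - z * cnj z * deriv h z) / 2"
  shows "(u_of h has_derivative (\<lambda>v. A * v - z\<^sup>2 * deriv h z / 2 * cnj v)) (at z)"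
proof -
  have dh: "(h has_derivative (*) (deriv h z)) (at z)" "(deriv h has_derivative (*) (deriv (deriv h) z)) (at z)"
    unfolding has_field_derivative_def[symmetric]
    using h z by (auto intro!: holomorphic_derivI holomorphic_deriv)
  have "u_of h = (\<lambda>z. h z + (1/2) * (1 - z * cnj z) * z * deriv h z)"
    by (rule ext) (simp add: u_of_def mult_cnj_eq_cmod_sq)
  moreover have "((\<lambda>z. h z + (1/2) * (1 - z * cnj z) * z * deriv h z) has_derivative
      (\<lambda>v. A * v - z\<^sup>2 * deriv h z / 2 * cnj v)) (at z)"
    by (rule derivative_eq_intros has_derivative_cnj dh refl | (rule ext, simp add: A_def field_simps power2_eq_square))+
  ultimately show ?thesis by simp
qed

lemma sense_preserving_u_of:
  assumes h: "h holomorphic_on ball 0 1" and S: "S \<subseteq> ball 0 1"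
    and nz: "\<And>z. z \<in> S \<Longrightarrow> deriv h z \<noteq> 0"
    and Re: "\<And>z. z \<in> S \<Longrightarrow> 2 * (cmod z)\<^sup>2 - 2 < (1 - (cmod z)\<^sup>2) * Re (1 + z * deriv (deriv h) z / deriv h z)"
  shows "sense_preserving (u_of h) S"
proof -
  define A where "A z = deriv h z + ((1 - z * cnj z) * (deriv h z + z * deriv (deriv h) z) - z * cnj z * deriv h z) / 2" for z
  have der: "(u_of h has_derivative (\<lambda>v. A z * v - z\<^sup>2 * deriv h z / 2 * cnj v)) (at z)" if "z \<in> S" for z
    unfolding A_def using u_of_has_derivative[OF h] S that by auto
  have fd: "frechet_derivative (u_of h) (at z) = (\<lambda>v. A z * v - z\<^sup>2 * deriv h z / 2 * cnj v)" if "z \<in> S" for z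
    using frechet_derivative_at[OF der[OF that]] by simp
  have "continuous_on (ball 0 1) (deriv h)" "continuous_on (ball 0 1) (deriv (deriv h))"
    using h by (auto intro!: holomorphic_on_imp_continuous_on holomorphic_deriv)
  then have cont: "continuous_on S (deriv h)" "continuous_on S (deriv (deriv h))"
    using S by (auto intro: continuous_on_subset)
  \<comment> \<open>The derivative is a point of a function space with the product topology, so
    continuity is checked for each fixed v.\<close>
  have "continuous_on S (\<lambda>z. frechet_derivative (u_of h) (at z) v)" for v
  proof -
    have "continuous_on S (\<lambda>z. A z * v - z\<^sup>2 * deriv h z / 2 * cnj v)"
      unfolding A_def by (intro continuous_intros cont) auto
    then show ?thesis by (rule continuous_on_eq) (simp add: fd)
  qed
  then have "continuous_on S (\<lambda>z. frechet_derivative (u_of h) (at z))"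
    by (rule continuous_on_coordinatewise_then_product)
  moreover have "jacobian_c (u_of h) z > 0" if z: "z \<in> S" for z
  proof -
    let ?r = "cmod z" and ?P = "1 + z * deriv (deriv h) z / deriv h z"
    \<comment> \<open>\<open>W\<close> is u_z divided by h'/2, while |u_zbar| divided by |h'|/2 is
      |z|^2. The assumption \<open>Re\<close> is exactly Re W > |z|^2.\<close>
    define W where "W = 2 - of_real (?r\<^sup>2) + of_real (1 - ?r\<^sup>2) * ?P"
    have wz: "wirtinger_z (u_of h) z = A z" and wzb: "wirtinger_zbar (u_of h) z = - z\<^sup>2 * deriv h z / 2"
      by (simp_all add: wirtinger_z_def wirtinger_zbar_def fd[OF z] algebra_simps)
    have "A z = deriv h z / 2 * W"
      using nz[OF z] unfolding A_def W_def of_real_diff of_real_power of_real_1 mult_cnj_eq_cmod_sq[symmetric]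
      by (simp add: field_simps)
    then have cA: "cmod (A z) = cmod (deriv h z) / 2 * cmod W"
      by (simp only: norm_mult norm_divide norm_numeral)
    have "Re W = 2 - ?r\<^sup>2 + (1 - ?r\<^sup>2) * Re ?P"
      unfolding W_def by (simp only: plus_complex.sel minus_complex.sel Re_complex_of_real times_complex.sel Im_complex_of_real) simp
    then have "?r\<^sup>2 < Re W" using Re[OF z] by simp
    also have "Re W \<le> cmod W" by (rule complex_Re_le_cmod)
    finally have "cmod (deriv h z) / 2 * ?r\<^sup>2 < cmod (A z)"
      unfolding cA using nz[OF z] by simp
    moreover have "cmod (- z\<^sup>2 * deriv h z / 2) = cmod (deriv h z) / 2 * ?r\<^sup>2"
      by (simp add: norm_mult norm_divide norm_power)
    ultimately show ?thesis
      unfolding jacobian_c_def wz wzb by (simp add: power_strict_mono)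
  qed
  ultimately show ?thesis
    unfolding sense_preserving_def using der by (auto simp: differentiable_def)
qed

theorem theorem1:
  fixes h :: "complex \<Rightarrow> complex"
  assumes "h holomorphic_on ball 0 1" and "h 0 = 0" and "deriv h 0 = 1"
  shows "(inj_on h (ball 0 1) \<and> convex (h ` ball 0 1) \<longrightarrow> sense_preserving (u_of h) (ball 0 1))
    \<and> (\<forall>\<alpha>. -1/2 \<le> \<alpha> \<and> \<alpha> < 0 \<and> convex_of_order \<alpha> h \<longrightarrow> sense_preserving (u_of h) (ball 0 1))
    \<and> (inj_on h (ball 0 1) \<longrightarrow> sense_preserving (u_of h) (ball 0 (sqrt 7 - 2)))"
proof (intro conjI allI impI; (elim conjE)?)
  note h = assms(1)
  have nz: "deriv h z \<noteq> 0" if "inj_on h (ball 0 1)" "z \<in> ball 0 1" for z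
    by (rule holomorphic_injective_imp_regular[OF h open_ball that])
  \<comment> \<open>Precomposition with a disk automorphism preserves injectivity and the image, so
    both coefficient bounds apply to the composite.\<close>
  have trans: "(h \<circ> Moebius_function 0 (- z)) holomorphic_on ball 0 1"
    "inj_on h (ball 0 1) \<Longrightarrow> inj_on (h \<circ> Moebius_function 0 (- z)) (ball 0 1)"
    "(h \<circ> Moebius_function 0 (- z)) ` ball 0 1 = h ` ball 0 1" if "z \<in> ball 0 1" for z
  proof -
    have z: "cmod (- z) < 1" using that by simp
    note M = Moebius_image_ball[OF z]
    show "(h \<circ> Moebius_function 0 (- z)) holomorphic_on ball 0 1"
      using h M(1) by (intro holomorphic_on_compose Moebius_function_holomorphic z) simp
    show "inj_on (h \<circ> Moebius_function 0 (- z)) (ball 0 1)" if "inj_on h (ball 0 1)"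
      using that M by (intro comp_inj_on) simp_all
    show "(h \<circ> Moebius_function 0 (- z)) ` ball 0 1 = h ` ball 0 1"
      using M(1) by (simp only: image_comp[symmetric])
  qed
  have bound: "1 + (cmod z)\<^sup>2 - C * cmod z \<le> (1 - (cmod z)\<^sup>2) * Re (1 + z * deriv (deriv h) z / deriv h z)"
    if "inj_on h (ball 0 1)" "z \<in> ball 0 1"
      "cmod (deriv (deriv (h \<circ> Moebius_function 0 (- z))) 0) \<le> C * cmod (deriv (h \<circ> Moebius_function 0 (- z)) 0)" for z C
    using that by (intro Re_pre_schwarzian_lower_bound deriv2_bound_transport nz h)
  show "sense_preserving (u_of h) (ball 0 1)" if "inj_on h (ball 0 1)" "convex (h ` ball 0 1)"
  proof (rule sense_preserving_u_of[OF h order_refl nz[OF that(1)]])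
    fix z :: complex assume z: "z \<in> ball 0 1"
    \<comment> \<open>For C = 2 and r = |z| the criterion reads r^2 + 2 r - 3 < 0, which factors as
      shown.\<close>
    have "0 < (3 + cmod z) * (1 - cmod z)"
      using z by (intro mult_pos_pos) (auto simp: add_pos_nonneg)
    also have "\<dots> = 1 + (cmod z)\<^sup>2 - 2 * cmod z - (2 * (cmod z)\<^sup>2 - 2)"
      by (simp add: power2_eq_square algebra_simps)
    finally show "2 * (cmod z)\<^sup>2 - 2 < (1 - (cmod z)\<^sup>2) * Re (1 + z * deriv (deriv h) z / deriv h z)"
      using bound[OF that(1) z, of 2] deriv2_at_zero_le_if_convex_image[OF trans(1,2)[OF z]] trans(3)[OF z] that
      by simp
  qed
  show "sense_preserving (u_of h) (ball 0 1)" if "-1/2 \<le> \<alpha>" "convex_of_order \<alpha> h" for \<alpha>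
  proof (rule sense_preserving_u_of[OF h order_refl])
    fix z :: complex assume z: "z \<in> ball 0 1"
    show "deriv h z \<noteq> 0" using that z by (simp add: convex_of_order_def)
    let ?P = "1 + z * deriv (deriv h) z / deriv h z"
    have "Re ?P > \<alpha>" using that(2) z unfolding convex_of_order_def by blast
    \<comment> \<open>Since 2 r^2 - 2 = (1 - r^2) (-2), the criterion amounts to Re P > -2.\<close>
    then have "Re ?P > - 2" using that(1) by simp
    moreover have "(cmod z)\<^sup>2 < 1" using z by (simp add: power_less_one_iff)
    ultimately have "(1 - (cmod z)\<^sup>2) * (- 2) < (1 - (cmod z)\<^sup>2) * Re ?P"
      by (intro mult_strict_left_mono) auto
    then show "2 * (cmod z)\<^sup>2 - 2 < (1 - (cmod z)\<^sup>2) * Re ?P" by simp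
  qed
  show "sense_preserving (u_of h) (ball 0 (sqrt 7 - 2))" if "inj_on h (ball 0 1)"
  proof (rule sense_preserving_u_of[OF h])
    have "sqrt 7 < (3::real)" by (rule real_less_lsqrt) auto
    then show sub: "ball 0 (sqrt 7 - 2) \<subseteq> ball (0::complex) 1" by auto
    fix z :: complex assume zS: "z \<in> ball 0 (sqrt 7 - 2)"
    with sub have z: "z \<in> ball 0 1" by blast
    show "deriv h z \<noteq> 0" by (rule nz[OF that z])
    \<comment> \<open>For C = 4 and r = |z| the criterion reads r^2 + 4 r < 3, that is (r + 2)^2 <
      7, whence the radius.\<close>
    have "(cmod z + 2)\<^sup>2 < (sqrt 7)\<^sup>2"
      using zS by (intro power_strict_mono) auto
    then have "2 * (cmod z)\<^sup>2 - 2 < 1 + (cmod z)\<^sup>2 - 4 * cmod z"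
      by (simp add: power2_sum)
    then show "2 * (cmod z)\<^sup>2 - 2 < (1 - (cmod z)\<^sup>2) * Re (1 + z * deriv (deriv h) z / deriv h z)"
      using bound[OF that z, of 4] deriv2_at_zero_le_if_inj[OF trans(1,2)[OF z]] that by simp
  qed
qed

end
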